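(* Consider problem (P) and suppose Assumptions A, B, C and D hold and that $\bar F$ is a KL function. Let $\{(x^t,L_g^t)\}$ be generated by SCP$_{ls}$ and let $\Omega$ be the set of accumulation points of $\{(x^{t+1},x^t,L_g^t)\}$. Then $\{x^t\}$ converges to a stationary point $x^*$ of (P). Moreover, if $\bar F$ satisfies the KL property with exponent $\alpha\in[0,1)$ at every point of $\Omega$, then there exists $\underline t\in\mathbb N_+$ such that: (i) if $\alpha=0$, then $x^t=x^*$ for all $t>\underline t$; (ii) if $\alpha\in(0,\frac12]$, then there exist $a_0\in(0,1)$ and $a_1>0$ with $\|x^t-x^*\|\le a_1a_0^t$ for all $t>\underline t$; (iii) if $\alpha\in(\frac12,1)$, then there exists $a_2>0$ with $\|x^t-x^*\|\le a_2t^{-\frac{1-\alpha}{2\alpha-1}}$ for all $t>\underline t$.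
   Context: Problem (P): $\min_{x\in\mathbb R^n}F(x):=f(x)+P_1(x)-P_2(x)+\delta_{\{g\le 0\}}(x)$, where $f:\mathbb R^n\to\mathbb R$ is continuously differentiable, $P_1,P_2:\mathbb R^n\to\mathbb R$ are convex and continuous, $g=(g_1,\dots,g_m):\mathbb R^n\to\mathbb R^m$ is continuous with $\{x:g(x)\le0\}\neq\emptyset$ (componentwise inequalities), $\delta_C$ the indicator function of $C$; $\partial$ is the limiting subdifferential. Assumption A: (i) $\nabla f$ is Lipschitz with modulus $L_f$; (ii) each $g_i$ is differentiable with $\nabla g_i$ Lipschitz with modulus $L_{g_i}$; (iii) $F$ is level-bounded. Assumption B (MFCQ): each $g_i$ is continuously differentiable and for every $x$ with $g(x)\le0$ there is $d$ with $\langle\nabla g_i(x),d\rangle<0$ for all $i\in I(x):=\{j:g_j(x)=0\}$. Assumption C: each $g_i$ is twice continuously differentiable. Assumption D: $P_2$ is continuously differentiable on an open set $\Gamma$ containing all stationary points of (P), and $\nabla P_2$ is locally Lipschitz on $\Gamma$. Stationary point: $x$ with $g(x)\le0$ for which there is $\lambda\in\mathbb R^m_+$ with $\lambda_ig_i(x)=0$ for all $i$ and $0\in\nabla f(x)+\partial P_1(x)-\partial P_2(x)+\sum_i\lambda_i\nabla g_i(x)$. $\bar G(x,y,w)\in\mathbb R^m$ has components $\bar G_i(x,y,w)=g_i(y)+\langle\nabla g_i(y),x-y\rangle+\frac{w_i}{2}\|x-y\|^2$, and $\bar F(x,y,w):=f(x)+P_1(x)-P_2(x)+\delta_{\{\bar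 G\le0\}}(x,y,w)$ on $\mathbb R^n\times\mathbb R^n\times\mathbb R^m$. KL property: a proper closed $h$ satisfies the KL property at $\hat x\in{\rm dom}\,\partial h$ if there exist $a\in(0,\infty]$, a neighborhood $V$ of $\hat x$ and a continuous concave $\varphi:[0,a)\to[0,\infty)$ with $\varphi(0)=0$, $\varphi$ continuously differentiable on $(0,a)$ with $\varphi'>0$, such that $\varphi'(h(x)-h(\hat x))\,{\rm dist}(0,\partial h(x))\ge1$ for all $x\in V$ with $h(\hat x)<h(x)<h(\hat x)+a$. It has the KL property at $\hat x$ with exponent $\alpha\in[0,1)$ if $\varphi$ can be taken as $\varphi(s)=a_0s^{1-\alpha}$ with $a_0>0$. $h$ is a KL function if it has the KL property at every point of ${\rm dom}\,\partial h$. Algorithm SCP$_{ls}$: fix $c>0$, $0<\underline L<\bar L$, $\tau>1$ and $x^0$ with $g(x^0)\le0$. For $t=0,1,2,\dots$: (1) pick any $\xi^t\in\partial P_2(x^t)$; (2) choose $L_f^{t,0}\in[\underline L,\bar L]$, $L_g^{t,0}\in[\underline L,\bar L]^m$ arbitrarily, set $\tilde L_f=L_f^{t,0}$, $\tilde L_g=L_g^{t,0}$; (3) compute $\tilde x$ solving: minimize $\langle\nabla f(x^t)-\xi^t,x-x^t\rangle+\frac{\tilde L_f}{2}\|x-x^t\|^2+P_1(x)$ subject to $\bar G(x,x^t,\tilde L_g)\le0$. If $g(\tilde x)\le0$ and $F(\tilde x)\le F(x^t)-\frac c2\|\tilde x-x^t\|^2$, set $x^{t+1}=\tilde x$, $L_f^t=\tilde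 L_f$, $L_g^t=\tilde L_g$ and go to iteration $t+1$; otherwise, if $g(\tilde x)\not\le0$ replace $\tilde L_g$ by $\tau\tilde L_g$, while if $g(\tilde x)\le0$ but the decrease inequality fails replace $\tilde L_f$ by $\tau\tilde L_f$, and repeat step (3). *)

theory Defs
  imports "HOL-Analysis.Analysis"
begin

text \<open>Extended-real-valued functions are modelled as maps into ereal.
  Frechet (regular) subdifferential: h x finite and
  liminf_{y -> x, y ~= x} (h y - h x - <v, y - x>) / norm (y - x) >= 0,
  written out with epsilon and delta.\<close>

definition frechet_subdiff :: "('a::euclidean_space \<Rightarrow> ereal) \<Rightarrow> 'a \<Rightarrow> 'a set" where
  "frechet_subdiff h x =
     {v. \<bar>h x\<bar> \<noteq> \<infinity> \<and>
         (\<forall>e>0. \<exists>d>0. \<forall>y. norm (y - x) < d \<longrightarrow>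
             h x + ereal (inner v (y - x) - e * norm (y - x)) \<le> h y)}"

definition lim_subdiff :: "('a::euclidean_space \<Rightarrow> ereal) \<Rightarrow> 'a \<Rightarrow> 'a set" where
  "lim_subdiff h x =
     {v. \<bar>h x\<bar> \<noteq> \<infinity> \<and>
         (\<exists>xs vs. xs \<longlonglongrightarrow> x \<and> (\<lambda>k. h (xs k)) \<longlonglongrightarrow> h x \<and> vs \<longlonglongrightarrow> v \<and>
                  (\<forall>k. vs k \<in> frechet_subdiff h (xs k)))}"

definition proper_closed :: "('a::euclidean_space \<Rightarrow> ereal) \<Rightarrow> bool" where
  "proper_closed h \<longleftrightarrow> (\<forall>x. h x \<noteq> -\<infinity>) \<and> (\<exists>x. h x \<noteq> \<infinity>) \<and>
      closed {(x, r). h x \<le> ereal r}"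

definition desing :: "ereal \<Rightarrow> (real \<Rightarrow> real) \<Rightarrow> bool" where
  "desing a \<phi> \<longleftrightarrow> 0 < a \<and>
     continuous_on {s. 0 \<le> s \<and> ereal s < a} \<phi> \<and>
     concave_on {s. 0 \<le> s \<and> ereal s < a} \<phi> \<and>
     \<phi> 0 = 0 \<and> (\<forall>s. 0 \<le> s \<and> ereal s < a \<longrightarrow> 0 \<le> \<phi> s) \<and>
     (\<forall>s. 0 < s \<and> ereal s < a \<longrightarrow> \<phi> differentiable (at s)) \<and>
     continuous_on {s. 0 < s \<and> ereal s < a} (deriv \<phi>) \<and>
     (\<forall>s. 0 < s \<and> ereal s < a \<longrightarrow> 0 < deriv \<phi> s)"

text \<open>KL inequality with given a, phi, neighbourhood V.  The inequality
  phi'(h x - h xh) * dist(0, lim_subdiff h x) >= 1 is written pointwise over the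
  subgradients (dist to the empty set being +infinity).\<close>

definition KL_with :: "('a::euclidean_space \<Rightarrow> ereal) \<Rightarrow> 'a \<Rightarrow> ereal \<Rightarrow> (real \<Rightarrow> real) \<Rightarrow> 'a set \<Rightarrow> bool" where
  "KL_with h xh a \<phi> V \<longleftrightarrow> desing a \<phi> \<and> open V \<and> xh \<in> V \<and>
     (\<forall>x\<in>V. h xh < h x \<and> h x < h xh + a \<longrightarrow>
        (\<forall>v\<in>lim_subdiff h x. 1 \<le> deriv \<phi> (real_of_ereal (h x - h xh)) * norm v))"

definition KL_at :: "('a::euclidean_space \<Rightarrow> ereal) \<Rightarrow> 'a \<Rightarrow> bool" where
  "KL_at h xh \<longleftrightarrow> lim_subdiff h xh \<noteq> {} \<and> (\<exists>a \<phi> V. KL_with h xh a \<phi> V)"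

definition KL_exp_at :: "('a::euclidean_space \<Rightarrow> ereal) \<Rightarrow> 'a \<Rightarrow> real \<Rightarrow> bool" where
  "KL_exp_at h xh \<alpha> \<longleftrightarrow> lim_subdiff h xh \<noteq> {} \<and>
     (\<exists>a0>0. \<exists>a V. KL_with h xh a (\<lambda>s. a0 * s powr (1 - \<alpha>)) V)"

definition KL_function :: "('a::euclidean_space \<Rightarrow> ereal) \<Rightarrow> bool" where
  "KL_function h \<longleftrightarrow> proper_closed h \<and> (\<forall>x. lim_subdiff h x \<noteq> {} \<longrightarrow> KL_at h x)"

text \<open>g is given componentwise: g i, with gradient dg i; f has gradient df.\<close>

definition feasible :: "('m::finite \<Rightarrow> real^'n::finite \<Rightarrow> real) \<Rightarrow> real^'n \<Rightarrow> bool" where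
  "feasible g x \<longleftrightarrow> (\<forall>i. g i x \<le> 0)"

definition Fobj :: "(real^'n::finite \<Rightarrow> real) \<Rightarrow> (real^'n \<Rightarrow> real) \<Rightarrow> (real^'n \<Rightarrow> real) \<Rightarrow>
     ('m::finite \<Rightarrow> real^'n \<Rightarrow> real) \<Rightarrow> real^'n \<Rightarrow> ereal" where
  "Fobj f P1 P2 g x = (if feasible g x then ereal (f x + P1 x - P2 x) else \<infinity>)"

definition stationary :: "(real^'n::finite \<Rightarrow> real^'n) \<Rightarrow> (real^'n \<Rightarrow> real) \<Rightarrow> (real^'n \<Rightarrow> real) \<Rightarrow>
     ('m::finite \<Rightarrow> real^'n \<Rightarrow> real) \<Rightarrow> ('m \<Rightarrow> real^'n \<Rightarrow> real^'n) \<Rightarrow> real^'n \<Rightarrow> bool" where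
  "stationary df P1 P2 g dg x \<longleftrightarrow> feasible g x \<and>
     (\<exists>lam::'m \<Rightarrow> real. (\<forall>i. 0 \<le> lam i \<and> lam i * g i x = 0) \<and>
        (\<exists>u\<in>lim_subdiff (\<lambda>y. ereal (P1 y)) x. \<exists>w\<in>lim_subdiff (\<lambda>y. ereal (P2 y)) x.
           df x + u - w + (\<Sum>i\<in>UNIV. lam i *\<^sub>R dg i x) = 0))"

definition Gbar :: "('m::finite \<Rightarrow> real^'n::finite \<Rightarrow> real) \<Rightarrow> ('m \<Rightarrow> real^'n \<Rightarrow> real^'n) \<Rightarrow>
     'm \<Rightarrow> real^'n \<Rightarrow> real^'n \<Rightarrow> real^'m \<Rightarrow> real" where
  "Gbar g dg i x y w = g i y + inner (dg i y) (x - y) + w $ i / 2 * (norm (x - y))\<^sup>2"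

definition Fbar :: "(real^'n::finite \<Rightarrow> real) \<Rightarrow> (real^'n \<Rightarrow> real) \<Rightarrow> (real^'n \<Rightarrow> real) \<Rightarrow>
     ('m::finite \<Rightarrow> real^'n \<Rightarrow> real) \<Rightarrow> ('m \<Rightarrow> real^'n \<Rightarrow> real^'n) \<Rightarrow>
     (real^'n) \<times> (real^'n) \<times> (real^'m) \<Rightarrow> ereal" where
  "Fbar f P1 P2 g dg p = (case p of (x, y, w) \<Rightarrow>
     if (\<forall>i. Gbar g dg i x y w \<le> 0) then ereal (f x + P1 x - P2 x) else \<infinity>)"

definition subprob_sol :: "(real^'n::finite \<Rightarrow> real^'n) \<Rightarrow> (real^'n \<Rightarrow> real) \<Rightarrow>
     ('m::finite \<Rightarrow> real^'n \<Rightarrow> real) \<Rightarrow> ('m \<Rightarrow> real^'n \<Rightarrow> real^'n) \<Rightarrow>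
     real^'n \<Rightarrow> real^'n \<Rightarrow> real \<Rightarrow> real^'m \<Rightarrow> real^'n \<Rightarrow> bool" where
  "subprob_sol df P1 g dg xt \<xi> lf lg z \<longleftrightarrow>
     (\<forall>i. Gbar g dg i z xt lg \<le> 0) \<and>
     (\<forall>y. (\<forall>i. Gbar g dg i y xt lg \<le> 0) \<longrightarrow>
        inner (df xt - \<xi>) (z - xt) + lf / 2 * (norm (z - xt))\<^sup>2 + P1 z
          \<le> inner (df xt - \<xi>) (y - xt) + lf / 2 * (norm (y - xt))\<^sup>2 + P1 y)"

definition accept :: "(real^'n::finite \<Rightarrow> real) \<Rightarrow> (real^'n \<Rightarrow> real) \<Rightarrow> (real^'n \<Rightarrow> real) \<Rightarrow>
     ('m::finite \<Rightarrow> real^'n \<Rightarrow> real) \<Rightarrow> real \<Rightarrow> real^'n \<Rightarrow> real^'n \<Rightarrow> bool" where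
  "accept f P1 P2 g c xt z \<longleftrightarrow> feasible g z \<and>
     Fobj f P1 P2 g z \<le> Fobj f P1 P2 g xt - ereal (c / 2 * (norm (z - xt))\<^sup>2)"

definition SCP_ls_seq :: "(real^'n::finite \<Rightarrow> real) \<Rightarrow> (real^'n \<Rightarrow> real^'n) \<Rightarrow>
     (real^'n \<Rightarrow> real) \<Rightarrow> (real^'n \<Rightarrow> real) \<Rightarrow>
     ('m::finite \<Rightarrow> real^'n \<Rightarrow> real) \<Rightarrow> ('m \<Rightarrow> real^'n \<Rightarrow> real^'n) \<Rightarrow>
     real \<Rightarrow> real \<Rightarrow> real \<Rightarrow> real \<Rightarrow>
     (nat \<Rightarrow> real^'n) \<Rightarrow> (nat \<Rightarrow> real^'n) \<Rightarrow> (nat \<Rightarrow> real) \<Rightarrow> (nat \<Rightarrow> real^'m) \<Rightarrow> bool" where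
  "SCP_ls_seq f df P1 P2 g dg c Llo Lhi \<tau> x \<xi> Lf Lg \<longleftrightarrow>
     0 < c \<and> 0 < Llo \<and> Llo < Lhi \<and> 1 < \<tau> \<and> feasible g (x 0) \<and>
     (\<forall>t. \<xi> t \<in> lim_subdiff (\<lambda>y. ereal (P2 y)) (x t) \<and>
        (\<exists>K::nat. \<exists>LF::nat \<Rightarrow> real. \<exists>LG::nat \<Rightarrow> real^'m. \<exists>Z::nat \<Rightarrow> real^'n.
           LF 0 \<in> {Llo..Lhi} \<and> (\<forall>i. LG 0 $ i \<in> {Llo..Lhi}) \<and>
           (\<forall>k\<le>K. subprob_sol df P1 g dg (x t) (\<xi> t) (LF k) (LG k) (Z k)) \<and>
           (\<forall>k<K. \<not> accept f P1 P2 g c (x t) (Z k) \<and>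
              (if \<not> feasible g (Z k)
               then LG (Suc k) = \<tau> *\<^sub>R LG k \<and> LF (Suc k) = LF k
               else LF (Suc k) = \<tau> * LF k \<and> LG (Suc k) = LG k)) \<and>
           accept f P1 P2 g c (x t) (Z K) \<and>
           x (Suc t) = Z K \<and> Lf t = LF K \<and> Lg t = LG K))"

definition AssumptionA :: "(real^'n::finite \<Rightarrow> real) \<Rightarrow> (real^'n \<Rightarrow> real^'n) \<Rightarrow>
     (real^'n \<Rightarrow> real) \<Rightarrow> (real^'n \<Rightarrow> real) \<Rightarrow>
     ('m::finite \<Rightarrow> real^'n \<Rightarrow> real) \<Rightarrow> ('m \<Rightarrow> real^'n \<Rightarrow> real^'n) \<Rightarrow> bool" where
  "AssumptionA f df P1 P2 g dg \<longleftrightarrow>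
     (\<exists>L. \<forall>x y. norm (df x - df y) \<le> L * norm (x - y)) \<and>
     (\<forall>i. (\<forall>x. (g i has_derivative (\<lambda>h. inner (dg i x) h)) (at x)) \<and>
          (\<exists>L. \<forall>x y. norm (dg i x - dg i y) \<le> L * norm (x - y))) \<and>
     (\<forall>r::real. bounded {x. Fobj f P1 P2 g x \<le> ereal r})"

definition AssumptionB :: "('m::finite \<Rightarrow> real^'n::finite \<Rightarrow> real) \<Rightarrow> ('m \<Rightarrow> real^'n \<Rightarrow> real^'n) \<Rightarrow> bool" where
  "AssumptionB g dg \<longleftrightarrow>
     (\<forall>i. (\<forall>x. (g i has_derivative (\<lambda>h. inner (dg i x) h)) (at x)) \<and> continuous_on UNIV (dg i)) \<and>
     (\<forall>x. feasible g x \<longrightarrow> (\<exists>d. \<forall>i. g i x = 0 \<longrightarrow> inner (dg i x) d < 0))"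

definition AssumptionC :: "('m::finite \<Rightarrow> real^'n::finite \<Rightarrow> real) \<Rightarrow> ('m \<Rightarrow> real^'n \<Rightarrow> real^'n) \<Rightarrow> bool" where
  "AssumptionC g dg \<longleftrightarrow>
     (\<forall>i. (\<forall>x. (g i has_derivative (\<lambda>h. inner (dg i x) h)) (at x)) \<and>
          (\<exists>H::real^'n \<Rightarrow> real^'n^'n. (\<forall>x. (dg i has_derivative (\<lambda>h. H x *v h)) (at x)) \<and>
                continuous_on UNIV H))"

definition AssumptionD :: "(real^'n::finite \<Rightarrow> real^'n) \<Rightarrow> (real^'n \<Rightarrow> real) \<Rightarrow> (real^'n \<Rightarrow> real) \<Rightarrow>
     ('m::finite \<Rightarrow> real^'n \<Rightarrow> real) \<Rightarrow> ('m \<Rightarrow> real^'n \<Rightarrow> real^'n) \<Rightarrow> bool" where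
  "AssumptionD df P1 P2 g dg \<longleftrightarrow>
     (\<exists>\<Gamma> dP2. open \<Gamma> \<and> {x. stationary df P1 P2 g dg x} \<subseteq> \<Gamma> \<and>
        (\<forall>x\<in>\<Gamma>. (P2 has_derivative (\<lambda>h. inner (dP2 x) h)) (at x)) \<and>
        continuous_on \<Gamma> dP2 \<and>
        (\<forall>x\<in>\<Gamma>. \<exists>r>0. \<exists>L. \<forall>y\<in>ball x r \<inter> \<Gamma>. \<forall>z\<in>ball x r \<inter> \<Gamma>.
            norm (dP2 y - dP2 z) \<le> L * norm (y - z)))"

end

theory Submission
  imports Defs
begin

text \<open>
  Optimality of the subproblem together with MFCQ (a Slater point) gives Lagrange multipliers, which
  are bounded near every cluster point. They exhibit a Frechet subgradient of Fbar at the state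
  (x (t+1), x t, Lg t) whose norm is at most a multiple of norm (x (t+1) - x t); only the elementary
  inclusion of the subdifferential sum rule is needed, since multipliers with complementary slackness always
  give regular normals. The Kurdyka-Lojasiewicz inequality is made uniform over the compact
  cluster set of the states by summing the finitely many desingularizing functions of a subcover:
  this is necessary because the moduli Lg t need not converge. Combined with sufficient
  decrease it yields norm steps s (t+1) <= s t / 2 + const * (phi (H (t+1)) - phi (H (t+2))),
  hence finite length, and with phi s = a s^(1-alpha) a recursion for the tails of the length.
\<close>

subsection \<open>Subgradients\<close>

text \<open>The constraint of the subproblem moves with \<open>x t\<close> and \<open>Lg t\<close>,
  so its multipliers are complementary to \<open>Gbar\<close> at the state and not to
  \<open>g\<close> at \<open>x (Suc t)\<close>. This is why the analysis runs on
  \<open>Fbar\<close>, where base point and moduli are variables: the derivatives of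
  \<open>Gbar\<close> in these variables carry a factor \<open>x (Suc t) - x t\<close>, so they cost
  no more than one step. The value of \<open>Fbar\<close> at the state is the objective at
  \<open>x (Suc t)\<close>, while its subgradient is controlled by step \<open>t\<close>; hence the
  index shift in the recursion. The other obstacle is the concave term: \<open>\<xi> t\<close> is a
  subgradient of \<open>P2\<close> at \<open>x t\<close>, but \<open>Fbar\<close> contains
  \<open>P2\<close> at \<open>x (Suc t)\<close>. Assumption D repairs this mismatch only near
  stationary points, so stationarity of every cluster point has to precede the subgradient bound.
  The constants obtained from MFCQ and from Assumption D are local to a cluster point. Convergence
  is known only at the end, so they are made uniform by compactness.\<close>

definition csubdiff :: "('a::euclidean_space \<Rightarrow> real) \<Rightarrow> 'a \<Rightarrow> 'a set" where
  "csubdiff P x = {v. \<forall>y. P x + inner v (y - x) \<le> P y}"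

lemma frechet_subdiff_subset_lim_subdiff: "frechet_subdiff h x \<subseteq> lim_subdiff h x"
proof
  fix v assume v: "v \<in> frechet_subdiff h x"
  then have "\<bar>h x\<bar> \<noteq> \<infinity>" by (simp add: frechet_subdiff_def)
  moreover have "(\<lambda>k::nat. x) \<longlonglongrightarrow> x" "(\<lambda>k::nat. h x) \<longlonglongrightarrow> h x" "(\<lambda>k::nat. v) \<longlonglongrightarrow> v" by auto
  ultimately show "v \<in> lim_subdiff h x" using v unfolding lim_subdiff_def
    by (intro CollectI conjI exI[of _ "\<lambda>k::nat. x"] exI[of _ "\<lambda>k::nat. v"]) auto
qed

text \<open>The first-order expansion of \<open>\<Phi>\<close> at the contact point passes to
  \<open>h\<close> through the minorant inequality. All regular subgradients below are produced this
  way: from affine minorants of convex functions, from the Lagrangian for \<open>P1\<close>, and for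
  \<open>Fbar\<close> itself.\<close>

lemma smooth_minorant_frechet_subdiff:
  fixes h :: "'a::euclidean_space \<Rightarrow> ereal" and \<Phi> :: "'a \<Rightarrow> real"
  assumes "h p = ereal (\<Phi> p)" and min: "\<And>q. ereal (\<Phi> q) \<le> h q"
    and der: "(\<Phi> has_derivative (\<lambda>d. inner v d)) (at p)"
  shows "v \<in> frechet_subdiff h p"
proof -
  have "\<exists>d>0. \<forall>y. norm (y - p) < d \<longrightarrow> h p + ereal (inner v (y - p) - e * norm (y - p)) \<le> h y"
    if "e > 0" for e
  proof -
    obtain d where d: "d > 0" "\<And>y. norm (y - p) < d \<Longrightarrow>
        norm (\<Phi> y - \<Phi> p - inner v (y - p)) \<le> e * norm (y - p)"
      using der \<open>e > 0\<close> unfolding has_derivative_at_alt by blast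
    have "h p + ereal (inner v (y - p) - e * norm (y - p)) \<le> h y" if "norm (y - p) < d" for y
    proof -
      have "\<Phi> p + (inner v (y - p) - e * norm (y - p)) \<le> \<Phi> y"
        using d(2)[OF that] by (simp add: abs_le_iff)
      then have "h p + ereal (inner v (y - p) - e * norm (y - p)) \<le> ereal (\<Phi> y)"
        using assms(1) by simp
      also have "\<dots> \<le> h y" by (rule min)
      finally show ?thesis .
    qed
    then show ?thesis using d(1) by blast
  qed
  then show ?thesis using assms(1) by (auto simp: frechet_subdiff_def)
qed

lemma csubdiff_subset_lim_subdiff: "csubdiff P x \<subseteq> lim_subdiff (\<lambda>y. ereal (P y)) x"
proof
  fix v assume v: "v \<in> csubdiff P x"
  have "v \<in> frechet_subdiff (\<lambda>y. ereal (P y)) x"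
  proof (rule smooth_minorant_frechet_subdiff[where \<Phi> = "\<lambda>y. P x + inner v (y - x)"])
    show "((\<lambda>y. P x + inner v (y - x)) has_derivative (\<lambda>d. inner v d)) (at x)"
      by (auto intro!: derivative_eq_intros)
  qed (use v in \<open>auto simp: csubdiff_def\<close>)
  then show "v \<in> lim_subdiff (\<lambda>y. ereal (P y)) x"
    using frechet_subdiff_subset_lim_subdiff by blast
qed

text \<open>Convexity makes the local inequality global: it is tested at a point of the segment from
  \<open>x\<close> to \<open>y\<close> close to \<open>x\<close>, and the chord bound lets the
  factor \<open>s\<close> cancel.\<close>

lemma frechet_subdiff_convex:
  assumes "convex_on UNIV P"
  shows "frechet_subdiff (\<lambda>y. ereal (P y)) x \<subseteq> csubdiff P x"
proof
  fix v assume v: "v \<in> frechet_subdiff (\<lambda>y. ereal (P y)) x"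
  have "P x + inner v (y - x) \<le> P y" for y
  proof (rule field_le_epsilon)
    fix e :: real assume "e > 0"
    \<comment> \<open>The error is scaled by the fixed distance to \<open>y\<close>, so that
      \<open>e' * norm (y - x) \<le> e\<close>; the added 1 covers \<open>y = x\<close>.\<close>
    define e' where "e' = e / (norm (y - x) + 1)"
    have "e' > 0" using \<open>e > 0\<close> by (simp add: e'_def add_nonneg_pos)
    then obtain d where d: "d > 0" "\<And>z. norm (z - x) < d \<Longrightarrow>
        P x + (inner v (z - x) - e' * norm (z - x)) \<le> P z"
      using v by (auto simp: frechet_subdiff_def)
    define s where "s = min 1 (d / (2 * (norm (y - x) + 1)))"
    have s: "0 < s" "s \<le> 1" using d(1) by (auto simp: s_def add_nonneg_pos)
    have "s * norm (y - x) \<le> d / (2 * (norm (y - x) + 1)) * norm (y - x)"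
      by (intro mult_right_mono) (auto simp: s_def)
    also have "\<dots> = d * (norm (y - x) / (2 * (norm (y - x) + 1)))" by simp
    also have "norm (y - x) / (2 * (norm (y - x) + 1)) < 1" by (simp add: divide_less_eq add_nonneg_pos)
    then have "d * (norm (y - x) / (2 * (norm (y - x) + 1))) < d * 1"
      using d(1) by (rule mult_strict_left_mono)
    finally have "s * norm (y - x) < d * 1" .
    then have sd: "s * norm (y - x) < d" by simp
    define z where "z = x + s *\<^sub>R (y - x)"
    have zx: "z - x = s *\<^sub>R (y - x)" by (simp add: z_def)
    have z: "z = (1 - s) *\<^sub>R x + s *\<^sub>R y" by (simp add: z_def algebra_simps)
    have "P x + s * (inner v (y - x) - e' * norm (y - x)) \<le> P z"
      using d(2)[of z] s sd unfolding zx by (simp add: right_diff_distrib mult.left_commute)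
    also have "P z \<le> (1 - s) * P x + s * P y"
      unfolding z using assms s by (intro convex_onD) auto
    finally have "s * (P x + (inner v (y - x) - e' * norm (y - x))) \<le> s * P y"
      by (simp add: algebra_simps)
    then have "P x + (inner v (y - x) - e' * norm (y - x)) \<le> P y" using s by simp
    moreover have "e' * norm (y - x) \<le> e"
    proof -
      have "e' * norm (y - x) \<le> e' * (norm (y - x) + 1)"
        using \<open>e' > 0\<close> by (intro mult_left_mono) auto
      also have "\<dots> = e" by (simp add: e'_def add_nonneg_pos[THEN less_imp_neq[THEN not_sym]])
      finally show ?thesis .
    qed
    ultimately show "P x + inner v (y - x) \<le> P y + e" by simp
  qed
  then show "v \<in> csubdiff P x" by (simp add: csubdiff_def)
qed

lemma csubdiff_limit:
  assumes "continuous_on UNIV P" "xs \<longlonglongrightarrow> x" "vs \<longlonglongrightarrow> v"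
    and "\<And>k. vs k \<in> csubdiff P (xs k)"
  shows "v \<in> csubdiff P x"
proof -
  have "P x + inner v (y - x) \<le> P y" for y
  proof (rule LIMSEQ_le_const2)
    show "(\<lambda>k. P (xs k) + inner (vs k) (y - xs k)) \<longlonglongrightarrow> P x + inner v (y - x)"
      using assms by (intro tendsto_intros continuous_on_tendsto_compose[of UNIV P]) auto
  qed (use assms(4) in \<open>auto simp: csubdiff_def\<close>)
  then show ?thesis by (simp add: csubdiff_def)
qed

text \<open>Subgradient inequalities survive limits when \<open>P\<close> is continuous, so limits
  of regular subgradients add nothing. This turns the choice of \<open>\<xi> t\<close> in the
  algorithm into a global affine minorant of \<open>P2\<close>.\<close>

lemma lim_subdiff_convex:
  assumes "convex_on UNIV P" "continuous_on UNIV P"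
  shows "lim_subdiff (\<lambda>y. ereal (P y)) x = csubdiff P x"
proof
  show "lim_subdiff (\<lambda>y. ereal (P y)) x \<subseteq> csubdiff P x"
    using csubdiff_limit[OF assms(2)] frechet_subdiff_convex[OF assms(1)]
    unfolding lim_subdiff_def by blast
qed (rule csubdiff_subset_lim_subdiff)

text \<open>\<open>P\<close> minus the linear function given by \<open>v\<close> is minimal at
  \<open>x\<close>, so its derivative vanishes there. It serves to identify \<open>\<xi> t\<close>
  with the gradient of \<open>P2\<close> near stationary points.\<close>

lemma csubdiff_gradient:
  assumes "(P has_derivative (\<lambda>h. inner d h)) (at x)" "v \<in> csubdiff P x"
  shows "v = d"
proof -
  have "((\<lambda>y. P y - inner v y) has_derivative (\<lambda>h. inner d h - inner v h)) (at x)"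
    by (auto intro!: derivative_eq_intros assms(1))
  moreover have "\<forall>\<^sub>F y in at x. P x - inner v x \<le> P y - inner v y"
    using assms(2) by (intro always_eventually) (auto simp: csubdiff_def inner_diff_right algebra_simps)
  ultimately have "(\<lambda>h. inner d h - inner v h) = (\<lambda>h. 0)"
    by (rule has_derivative_local_min)
  then have "inner (d - v) (d - v) = 0" by (metis inner_diff_left)
  then show ?thesis by simp
qed

text \<open>The subgradient inequality in the unit direction \<open>sgn v\<close> bounds
  \<open>norm v\<close> by the oscillation of \<open>P\<close> on a ball enlarged by one.\<close>

lemma csubdiff_bounded:
  assumes "continuous_on UNIV P" "bounded B"
  shows "\<exists>M. \<forall>x\<in>B. \<forall>v\<in>csubdiff P x. norm v \<le> M"
proof -
  obtain R where R: "\<And>x. x \<in> B \<Longrightarrow> norm x \<le> R" using assms(2) unfolding bounded_iff by blast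
  have "compact (P ` cball 0 (R + 1))"
    using assms(1) by (intro compact_continuous_image) (auto intro: continuous_on_subset)
  then have "bounded (P ` cball 0 (R + 1))" by (rule compact_imp_bounded)
  then obtain M where "\<forall>y\<in>cball 0 (R + 1). \<bar>P y\<bar> \<le> M" unfolding bounded_iff by auto
  then have M: "\<bar>P y\<bar> \<le> M" if "norm y \<le> R + 1" for y using that by simp
  have "norm v \<le> 2 * M" if "x \<in> B" "v \<in> csubdiff P x" for x v
  proof -
    have "norm (x + sgn v) \<le> R + 1"
      using R[OF that(1)] norm_triangle_ineq[of x "sgn v"] by (simp add: norm_sgn split: if_splits)
    moreover have "P x + inner v (sgn v) \<le> P (x + sgn v)"
      using that(2) by (auto simp: csubdiff_def dest: spec[of _ "x + sgn v"])
    moreover have "inner v (sgn v) = norm v"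
      by (cases "v = 0") (simp_all add: sgn_div_norm dot_square_norm power2_eq_square)
    ultimately show ?thesis using M[of "x + sgn v"] M[of x] R[OF that(1)] by linarith
  qed
  then show ?thesis by blast
qed

subsection \<open>Descent and multipliers\<close>

lemma Lipschitz_gradient_descent:
  fixes f :: "'a::euclidean_space \<Rightarrow> real"
  assumes der: "\<And>y. (f has_derivative (\<lambda>h. inner (df y) h)) (at y)"
    and lip: "\<And>x y. norm (df x - df y) \<le> L * norm (x - y)"
  shows "f y \<le> f x + inner (df x) (y - x) + L / 2 * (norm (y - x))\<^sup>2"
proof -
  define h where "h = y - x"
  \<comment> \<open>The claim is \<open>\<psi> 1 \<le> \<psi> 0\<close>; the subtracted terms are
    those for which Lipschitz continuity of the gradient along the segment makes the derivative
    nonpositive.\<close>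
  define \<psi> where "\<psi> s = f (x + s *\<^sub>R h) - s * inner (df x) h - L / 2 * s\<^sup>2 * (norm h)\<^sup>2" for s :: real
  have "\<psi> 1 \<le> \<psi> 0"
  proof (rule DERIV_nonpos_imp_nonincreasing[where f = \<psi>])
    fix s :: real assume s: "0 \<le> s" "s \<le> 1"
    have "((\<lambda>s. f (x + s *\<^sub>R h)) has_derivative (\<lambda>k. inner (df (x + s *\<^sub>R h)) (k *\<^sub>R h))) (at s)"
      by (rule has_derivative_compose[OF _ der]) (auto intro!: derivative_eq_intros)
    then have "((\<lambda>s. f (x + s *\<^sub>R h)) has_field_derivative inner (df (x + s *\<^sub>R h)) h) (at s)"
      by (simp add: has_field_derivative_def mult.commute[of _ "inner _ _"])
    then have "(\<psi> has_field_derivative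
        inner (df (x + s *\<^sub>R h)) h - inner (df x) h - L * s * (norm h)\<^sup>2) (at s)"
      unfolding \<psi>_def by (auto intro!: derivative_eq_intros)
    moreover have "inner (df (x + s *\<^sub>R h)) h - inner (df x) h - L * s * (norm h)\<^sup>2 \<le> 0"
    proof -
      have "inner (df (x + s *\<^sub>R h) - df x) h \<le> norm (df (x + s *\<^sub>R h) - df x) * norm h"
        by (rule norm_cauchy_schwarz)
      also have "\<dots> \<le> L * norm (s *\<^sub>R h) * norm h"
        using lip[of "x + s *\<^sub>R h" x] by (intro mult_right_mono) auto
      also have "\<dots> = L * s * (norm h)\<^sup>2" using s by (simp add: power2_eq_square)
      finally show ?thesis by (simp add: inner_diff_left)
    qed
    ultimately show "\<exists>y. (\<psi> has_real_derivative y) (at s) \<and> y \<le> 0" by blast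
  qed simp
  then show ?thesis by (simp add: \<psi>_def h_def)
qed

text \<open>Separation in the finite-dimensional space of constraint and objective values:
  optimality keeps the origin out of a convex set, and the Slater point makes the separating
  hyperplane non-vertical, so that it can be normalised.\<close>

lemma lagrange_multipliers:
  fixes \<phi> :: "'a::real_vector \<Rightarrow> real" and q :: "'m::finite \<Rightarrow> 'a \<Rightarrow> real"
  assumes cvx: "convex_on UNIV \<phi>" "\<And>i. convex_on UNIV (q i)"
    and feas: "\<And>i. q i z \<le> 0"
    and opt: "\<And>y. (\<And>i. q i y \<le> 0) \<Longrightarrow> \<phi> z \<le> \<phi> y"
    and slater: "\<And>i. q i y0 < 0"
  shows "\<exists>l::'m \<Rightarrow> real. (\<forall>i. 0 \<le> l i \<and> l i * q i z = 0) \<and>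
           (\<forall>y. \<phi> z \<le> \<phi> y + (\<Sum>i\<in>UNIV. l i * q i y))"
proof -
  \<comment> \<open>\<open>A\<close> is upward closed in every component. The strict inequality in
    the last one is what excludes the origin at an optimal \<open>z\<close>.\<close>
  define A where "A = {p::(real^'m) \<times> real. \<exists>y. (\<forall>i. q i y \<le> fst p $ i) \<and> \<phi> y - \<phi> z < snd p}"
  have "convex A"
  proof (rule convexI)
    fix p p' :: "(real^'m) \<times> real" and u v :: real
    assume "p \<in> A" "p' \<in> A" and uv: "0 \<le> u" "0 \<le> v" "u + v = 1"
    then obtain y y' where y: "\<And>i. q i y \<le> fst p $ i" "\<phi> y - \<phi> z < snd p"
      and y': "\<And>i. q i y' \<le> fst p' $ i" "\<phi> y' - \<phi> z < snd p'" unfolding A_def by blast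
    have cv: "r (u *\<^sub>R y + v *\<^sub>R y') \<le> u * r y + v * r y'" if "convex_on UNIV r" for r
    proof -
      have "u = 1 - v" using uv by simp
      show ?thesis using convex_onD[OF that, of v y y'] uv unfolding \<open>u = 1 - v\<close> by auto
    qed
    have "q i (u *\<^sub>R y + v *\<^sub>R y') \<le> fst (u *\<^sub>R p + v *\<^sub>R p') $ i" for i
    proof -
      have "q i (u *\<^sub>R y + v *\<^sub>R y') \<le> u * q i y + v * q i y'" by (rule cv[OF cvx(2)])
      also have "\<dots> \<le> u * fst p $ i + v * fst p' $ i"
        using y(1) y'(1) uv by (intro add_mono mult_left_mono) auto
      finally show ?thesis by simp
    qed
    moreover have "\<phi> (u *\<^sub>R y + v *\<^sub>R y') - \<phi> z < snd (u *\<^sub>R p + v *\<^sub>R p')"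
    proof -
      have "\<phi> (u *\<^sub>R y + v *\<^sub>R y') \<le> u * \<phi> y + v * \<phi> y'" by (rule cv[OF cvx(1)])
      moreover have "\<phi> z = u * \<phi> z + v * \<phi> z" using uv(3) by (metis distrib_right mult_1)
      moreover have "u * (\<phi> y - \<phi> z) + v * (\<phi> y' - \<phi> z) < u * snd p + v * snd p'"
      proof (cases "u = 0")
        case True then show ?thesis using y'(2) uv by simp
      next
        case False
        then have "u * (\<phi> y - \<phi> z) < u * snd p" using y(2) uv by simp
        moreover have "v * (\<phi> y' - \<phi> z) \<le> v * snd p'" using y'(2) uv by (intro mult_left_mono) auto
        ultimately show ?thesis by linarith
      qed
      ultimately show ?thesis by (simp add: algebra_simps)
    qed
    ultimately show "u *\<^sub>R p + v *\<^sub>R p' \<in> A" unfolding A_def by blast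
  qed
  moreover have "0 \<notin> A"
  proof
    assume "0 \<in> A"
    then obtain y where "\<And>i. q i y \<le> 0" "\<phi> y < \<phi> z" unfolding A_def by auto
    then show False using opt[of y] by simp
  qed
  ultimately have "\<exists>a. a \<noteq> 0 \<and> (\<forall>p\<in>A. 0 \<le> inner a p)"
    by (rule separating_hyperplane_set_0)
  then obtain a where a: "a \<noteq> 0" "\<And>p. p \<in> A \<Longrightarrow> 0 \<le> inner a p" by auto
  obtain \<mu> \<rho> where a_eq: "a = (\<mu>, \<rho>)" by (cases a)
  have sep: "0 \<le> inner \<mu> u + \<rho> * r" if "\<And>i. q i y \<le> u $ i" "\<phi> y - \<phi> z < r" for y u r
    using a(2)[of "(u, r)"] that unfolding A_def a_eq by (auto simp: inner_Pair)
  \<comment> \<open>An affine function that is nonnegative on a ray has nonnegative slope. Since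
    \<open>A\<close> is upward closed, this yields the signs of \<open>\<mu>\<close> and
    \<open>\<rho>\<close>.\<close>
  have nonneg: "0 \<le> m" if "\<And>k. k \<ge> 0 \<Longrightarrow> 0 \<le> b + k * m" for b m :: real
  proof (rule ccontr)
    assume "\<not> 0 \<le> m"
    then have "b + (\<bar>b\<bar> + 1) / (- m) * m < 0" "0 \<le> (\<bar>b\<bar> + 1) / (- m)" by (auto simp: divide_nonneg_neg)
    then show False using that[of "(\<bar>b\<bar> + 1) / (- m)"] by linarith
  qed
  have \<mu>: "0 \<le> \<mu> $ i" for i
  proof (rule nonneg)
    fix k :: real assume "k \<ge> 0"
    then have "0 \<le> inner \<mu> (k *\<^sub>R axis i 1) + \<rho> * 1"
      using feas by (intro sep[of z]) (auto simp: axis_def intro: order_trans)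
    then show "0 \<le> \<rho> + k * \<mu> $ i" by (simp add: inner_axis)
  qed
  have "0 \<le> \<rho>"
  proof (rule nonneg)
    fix k :: real assume "k \<ge> 0"
    then have "0 \<le> inner \<mu> 0 + \<rho> * (k + 1)"
      using feas by (intro sep[of z]) auto
    then show "0 \<le> \<rho> + k * \<rho>" by (simp add: algebra_simps)
  qed
  have inner_q: "inner \<mu> (\<chi> i. q i y) = (\<Sum>i\<in>UNIV. \<mu> $ i * q i y)" for y
    by (simp add: inner_vec_def)
  \<comment> \<open>If \<open>\<rho>\<close> vanished, a nonnegative combination of the negative
    numbers \<open>q i y0\<close> would be nonnegative, forcing \<open>\<mu> = 0\<close> and hence
    \<open>a = 0\<close>.\<close>
  have "\<rho> \<noteq> 0"
  proof
    assume "\<rho> = 0"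
    have "0 \<le> inner \<mu> (\<chi> i. q i y0) + \<rho> * (\<phi> y0 - \<phi> z + 1)" by (rule sep[of y0]) auto
    then have "0 \<le> (\<Sum>i\<in>UNIV. \<mu> $ i * q i y0)" by (simp add: \<open>\<rho> = 0\<close> inner_q)
    moreover have neg: "\<mu> $ i * q i y0 \<le> 0" for i
      using \<mu> slater by (simp add: mult_nonneg_nonpos less_imp_le)
    ultimately have "(\<Sum>i\<in>UNIV. - (\<mu> $ i * q i y0)) = 0"
      using sum_nonpos[of UNIV "\<lambda>i. \<mu> $ i * q i y0"] by (simp add: sum_negf)
    then have "\<mu> $ i * q i y0 = 0" for i
      using neg by (subst (asm) sum_nonneg_eq_0_iff) auto
    then have "\<mu> $ i = 0" for i using slater[of i] by (metis less_irrefl mult_eq_0_iff)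
    then show False using a(1) \<open>\<rho> = 0\<close> by (auto simp: a_eq vec_eq_iff zero_prod_def)
  qed
  then have "\<rho> > 0" using \<open>0 \<le> \<rho>\<close> by simp
  define l where "l i = \<mu> $ i / \<rho>" for i
  have l: "0 \<le> l i" for i using \<mu> \<open>\<rho> > 0\<close> by (simp add: l_def)
  have lag: "\<phi> z \<le> \<phi> y + (\<Sum>i\<in>UNIV. l i * q i y)" for y
  proof (rule field_le_epsilon)
    fix e :: real assume "e > 0"
    then have "0 \<le> inner \<mu> (\<chi> i. q i y) + \<rho> * (\<phi> y - \<phi> z + e)" by (intro sep[of y]) auto
    then have "0 \<le> ((\<Sum>i\<in>UNIV. \<mu> $ i * q i y) + \<rho> * (\<phi> y - \<phi> z + e)) / \<rho>"
      unfolding inner_q using \<open>\<rho> > 0\<close> by simp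
    also have "\<dots> = (\<Sum>i\<in>UNIV. l i * q i y) + (\<phi> y - \<phi> z + e)"
      using \<open>\<rho> > 0\<close> by (simp add: add_divide_distrib sum_divide_distrib l_def)
    finally show "\<phi> z \<le> \<phi> y + (\<Sum>i\<in>UNIV. l i * q i y) + e" by linarith
  qed
  \<comment> \<open>At \<open>y = z\<close> the Lagrangian inequality makes a sum of nonpositive
    terms nonnegative, which is complementary slackness.\<close>
  have neg: "l i * q i z \<le> 0" for i using l feas by (simp add: mult_nonneg_nonpos)
  then have "(\<Sum>i\<in>UNIV. - (l i * q i z)) = 0"
    using lag[of z] sum_nonpos[of UNIV "\<lambda>i. l i * q i z"] by (simp add: sum_negf)
  then have "l i * q i z = 0" for i
    using neg by (subst (asm) sum_nonneg_eq_0_iff) auto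
  then show ?thesis using l lag by blast
qed

subsection \<open>Cluster points\<close>

text \<open>The subsequence form matches the set \<open>\<Omega>\<close> of the theorem;
  \<open>cluster_point_iff\<close> supplies the metric form.\<close>

definition cluster_point :: "(nat \<Rightarrow> 'a::metric_space) \<Rightarrow> 'a \<Rightarrow> bool" where
  "cluster_point z p \<longleftrightarrow> (\<exists>r. strict_mono r \<and> (z \<circ> r) \<longlonglongrightarrow> p)"

lemma cluster_point_iff:
  "cluster_point z p \<longleftrightarrow> (\<forall>e>0. \<forall>N. \<exists>t\<ge>N. dist (z t) p < e)"
proof
  assume "cluster_point z p"
  then obtain r where r: "strict_mono r" "(z \<circ> r) \<longlonglongrightarrow> p" by (auto simp: cluster_point_def)
  show "\<forall>e>0. \<forall>N. \<exists>t\<ge>N. dist (z t) p < e"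
  proof (intro allI impI)
    fix e :: real and N assume "e > 0"
    then obtain k where "\<And>n. n \<ge> k \<Longrightarrow> dist (z (r n)) p < e"
      using r(2) unfolding lim_sequentially by auto
    then show "\<exists>t\<ge>N. dist (z t) p < e"
      using seq_suble[OF r(1), of "max k N"] by (intro exI[of _ "r (max k N)"]) auto
  qed
next
  assume *: "\<forall>e>0. \<forall>N. \<exists>t\<ge>N. dist (z t) p < e"
  have "\<exists>r. \<forall>n. dist (z (r n)) p < inverse (real (Suc n)) \<and> r n < r (Suc n)"
  proof (rule dependent_nat_choice)
    show "\<exists>t. dist (z t) p < inverse (real (Suc 0))" using *[rule_format, of 1 0] by auto
    fix t n
    show "\<exists>t'. dist (z t') p < inverse (real (Suc (Suc n))) \<and> t < t'"
      using *[rule_format, of "inverse (real (Suc (Suc n)))" "Suc t"] by (auto simp: Suc_le_eq)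
  qed
  then obtain r where r: "\<And>n. dist (z (r n)) p < inverse (real (Suc n))" "\<And>n. r n < r (Suc n)" by blast
  have "(\<lambda>n. dist (z (r n)) p) \<longlonglongrightarrow> 0"
    by (rule tendsto_sandwich[OF _ _ tendsto_const LIMSEQ_inverse_real_of_nat])
      (use r(1) in \<open>auto intro!: always_eventually less_imp_le\<close>)
  then have "(z \<circ> r) \<longlonglongrightarrow> p" by (subst tendsto_dist_iff) (simp add: o_def)
  then show "cluster_point z p" using r(2) unfolding cluster_point_def strict_mono_Suc_iff by blast
qed

lemma closed_cluster_points: "closed {p. cluster_point z p}"
  unfolding closed_sequential_limits
proof (intro allI impI, elim conjE)
  fix ps p assume ps: "\<forall>n. ps n \<in> {p. cluster_point z p}" "ps \<longlonglongrightarrow> p"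
  have "\<exists>t\<ge>N. dist (z t) p < e" if "e > 0" for e N
  proof -
    obtain n where n: "dist (ps n) p < e / 2" using metric_LIMSEQ_D[OF ps(2), of "e / 2"] \<open>e > 0\<close> by auto
    obtain t where "t \<ge> N" "dist (z t) (ps n) < e / 2"
      using ps(1) \<open>e > 0\<close> unfolding mem_Collect_eq cluster_point_iff by (meson half_gt_zero)
    then show ?thesis using n dist_triangle_half_l dist_commute by metis
  qed
  then show "p \<in> {p. cluster_point z p}" by (simp add: cluster_point_iff)
qed

text \<open>The indices \<open>t n\<close> need not increase, so \<open>t\<close> composed with
  \<open>s\<close> may fail to be a subsequence; \<open>n \<le> t n\<close> still reaches every
  tail, which is what the metric form of a cluster point asks for.\<close>

lemma bounded_subseq_cluster_point:
  fixes z :: "nat \<Rightarrow> 'a::euclidean_space"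
  assumes "bounded (range z)" and t: "\<And>n. n \<le> t n"
  obtains p s where "cluster_point z p" "strict_mono s" "(\<lambda>k. z (t (s k))) \<longlonglongrightarrow> p"
proof -
  have "bounded (range (\<lambda>n. z (t n)))" using assms(1) by (rule bounded_subset) auto
  then obtain p s where s: "strict_mono s" "((\<lambda>n. z (t n)) \<circ> s) \<longlonglongrightarrow> p"
    using bounded_imp_convergent_subsequence by metis
  have "cluster_point z p" unfolding cluster_point_iff
  proof (intro allI impI)
    fix e :: real and N assume "e > 0"
    then obtain k where "\<And>n. n \<ge> k \<Longrightarrow> dist (z (t (s n))) p < e"
      using s(2) unfolding lim_sequentially by auto
    moreover have "N \<le> t (s (max k N))"
      using seq_suble[OF s(1), of "max k N"] t[of "s (max k N)"] by linarith
    ultimately show "\<exists>t\<ge>N. dist (z t) p < e" by (intro exI[of _ "t (s (max k N))"]) auto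
  qed
  then show thesis using that s by (auto simp: o_def)
qed

lemma bounded_compact_cluster_points:
  fixes z :: "nat \<Rightarrow> 'a::euclidean_space"
  assumes "bounded (range z)"
  shows "compact {p. cluster_point z p}"
proof -
  have "{p. cluster_point z p} \<subseteq> closure (range z)"
    by (auto simp: cluster_point_iff closure_approachable) (meson)
  then show ?thesis using assms closed_cluster_points bounded_subset[OF bounded_closure]
    by (auto simp: compact_eq_bounded_closed)
qed

lemma eventually_near_cluster_points:
  fixes z :: "nat \<Rightarrow> 'a::euclidean_space"
  assumes "bounded (range z)" "open U" "\<And>p. cluster_point z p \<Longrightarrow> p \<in> U"
  shows "\<exists>T. \<forall>t\<ge>T. z t \<in> U"
proof (rule ccontr)
  assume "\<not> ?thesis"
  then obtain t where t: "\<And>n. n \<le> t n" "\<And>n. z (t n) \<notin> U" by metis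
  obtain p s where p: "cluster_point z p" "strict_mono s" "(\<lambda>k. z (t (s k))) \<longlonglongrightarrow> p"
    using bounded_subseq_cluster_point[OF assms(1) t(1)] .
  have "\<forall>\<^sub>F k in sequentially. z (t (s k)) \<in> U"
    using p(3) assms(2) assms(3)[OF p(1)] by (rule topological_tendstoD)
  then show False using t(2) by simp
qed

text \<open>Compactness by contradiction: indices violating the bound with constant \<open>n\<close>
  accumulate somewhere, and the local constant there is eventually exceeded by
  \<open>n\<close>.\<close>

lemma local_bound_at_cluster_points:
  fixes z :: "nat \<Rightarrow> 'a::euclidean_space"
  assumes "bounded (range z)"
    and loc: "\<And>p. cluster_point z p \<Longrightarrow> \<exists>C T. \<exists>r>0. \<forall>t\<ge>T. dist (z t) p < r \<longrightarrow> Q C t"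
    and mono: "\<And>C C' t. Q C t \<Longrightarrow> C \<le> C' \<Longrightarrow> Q C' t"
  shows "\<exists>C::real. \<exists>T. \<forall>t\<ge>T. Q C t"
proof (rule ccontr)
  assume "\<not> ?thesis"
  then have "\<forall>n. \<exists>t\<ge>n. \<not> Q (real n) t" by blast
  then obtain t where t: "\<And>n. n \<le> t n" "\<And>n. \<not> Q (real n) (t n)" by metis
  obtain p s where p: "cluster_point z p" "strict_mono s" "(\<lambda>k. z (t (s k))) \<longlonglongrightarrow> p"
    using bounded_subseq_cluster_point[OF assms(1) t(1)] .
  obtain C T r where r: "r > 0" "\<And>k. k \<ge> T \<Longrightarrow> dist (z k) p < r \<Longrightarrow> Q C k" using loc[OF p(1)] by blast
  obtain k0 where k0: "\<And>k. k \<ge> k0 \<Longrightarrow> dist (z (t (s k))) p < r"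
    using metric_LIMSEQ_D[OF p(3) r(1)] by blast
  obtain N where N: "C \<le> real N" using real_arch_simple by blast
  define k where "k = max k0 (max T N)"
  have "k \<le> s k" using seq_suble[OF p(2)] .
  then have "T \<le> t (s k)" "N \<le> s k" using t(1)[of "s k"] by (auto simp: k_def)
  then have "Q (real (s k)) (t (s k))"
    using mono[OF r(2)[OF _ k0]] N by (simp add: k_def)
  then show False using t(2) by blast
qed

subsection \<open>Finite length and rates from a Kurdyka-Lojasiewicz inequality\<close>

lemma desing_concave_tangent:
  assumes d: "desing a \<phi>" and s: "0 < s" "ereal s < a" and r: "0 \<le> r" "r \<le> s"
  shows "deriv \<phi> s * (s - r) \<le> \<phi> s - \<phi> r"
proof -
  \<comment> \<open>Room to the right of \<open>s\<close> makes it an interior point of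
    \<open>{0..b}\<close>, as the tangent inequality requires, while \<open>b\<close> stays in the
    domain of concavity.\<close>
  obtain b where b: "s < b" "ereal b < a" using ereal_dense2[OF s(2)] by auto
  have "concave_on {s. 0 \<le> s \<and> ereal s < a} \<phi>" using d by (simp add: desing_def)
  then have "convex_on {0..b} (\<lambda>s. - \<phi> s)" unfolding concave_on_def
  proof (rule convex_on_subset)
    have "ereal r < a" if "r \<le> b" for r
      using b(2) that by (metis ereal_less_eq(3) le_less_trans)
    then show "{0..b} \<subseteq> {s. 0 \<le> s \<and> ereal s < a}" by auto
  qed (simp add: convex_real_interval)
  moreover have "\<phi> differentiable (at s)" using d s unfolding desing_def by blast
  then have "(\<phi> has_real_derivative deriv \<phi> s) (at s)" by (simp add: DERIV_deriv_iff_real_differentiable)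
  then have "((\<lambda>s. - \<phi> s) has_real_derivative - deriv \<phi> s) (at s within {0..b})"
    by (rule has_field_derivative_at_within[OF DERIV_minus])
  ultimately have "- deriv \<phi> s * (r - s) \<le> - \<phi> r - - \<phi> s"
    using b s r by (intro convex_on_imp_above_tangent[where A = "{0..b}" and f = "\<lambda>s. - \<phi> s"]) auto
  then show ?thesis by (simp add: algebra_simps)
qed

text \<open>Multiplying the concavity estimate by the KL inequality at \<open>H (Suc t)\<close>
  cancels \<open>D\<close>: the square of \<open>\<Delta> (Suc t)\<close> is at most
  \<open>\<Delta> t\<close> times a multiple of the decrease of \<open>\<phi>\<close>. The
  arithmetic-geometric mean then leaves \<open>\<Delta> t\<close> with a factor one half, which
  summation absorbs. \<open>D\<close> is kept abstract so that a sum of derivatives can be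
  inserted.\<close>

lemma KL_recursion_finite_length:
  fixes H \<Delta> :: "nat \<Rightarrow> real" and \<phi> D :: "real \<Rightarrow> real"
  assumes "0 < \<kappa>" "0 < C" and H: "\<And>t. 0 \<le> H t" and \<Delta>: "\<And>t. 0 \<le> \<Delta> t"
    and descent: "\<And>t. \<kappa> * (\<Delta> t)\<^sup>2 \<le> H t - H (Suc t)"
    and KL: "\<And>t. T \<le> t \<Longrightarrow> 0 < H (Suc t) \<Longrightarrow> 1 \<le> D (H (Suc t)) * (C * \<Delta> t)"
    and \<phi>: "\<And>t. T \<le> t \<Longrightarrow> 0 \<le> \<phi> (H t)"
    and concave: "\<And>t. T \<le> t \<Longrightarrow> 0 < H t \<Longrightarrow> D (H t) * (H t - H (Suc t)) \<le> \<phi> (H t) - \<phi> (H (Suc t))"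
  shows "summable \<Delta>"
    and "\<And>t. T \<le> t \<Longrightarrow> (\<Sum>k. \<Delta> (k + Suc t)) \<le> \<Delta> t + C / \<kappa> * \<phi> (H (Suc t))"
proof -
  have step: "\<Delta> (Suc t) \<le> \<Delta> t / 2 + C / (2 * \<kappa>) * (\<phi> (H (Suc t)) - \<phi> (H (Suc (Suc t))))"
    if t: "T \<le> t" for t
  \<comment> \<open>At a closed gap the KL inequality says nothing; there descent forces the next
    step and the next gap to vanish, so the \<open>\<phi>\<close> terms cancel.\<close>
  proof (cases "H (Suc t) = 0")
    case True
    have 0: "0 \<le> \<kappa> * (\<Delta> (Suc t))\<^sup>2" using \<open>0 < \<kappa>\<close> by simp
    then have "H (Suc (Suc t)) = 0" "\<kappa> * (\<Delta> (Suc t))\<^sup>2 = 0"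
      using descent[of "Suc t"] H[of "Suc (Suc t)"] True by linarith+
    then have "\<Delta> (Suc t) = 0" "H (Suc (Suc t)) = 0" using \<open>0 < \<kappa>\<close> by auto
    then show ?thesis using \<Delta>[of t] True by simp
  next
    case False
    then have pos: "0 < H (Suc t)" using H[of "Suc t"] by simp
    define \<delta> where "\<delta> = \<phi> (H (Suc t)) - \<phi> (H (Suc (Suc t)))"
    have 1: "1 \<le> D (H (Suc t)) * (C * \<Delta> t)" by (rule KL[OF t pos])
    have "C * \<Delta> t \<ge> 0" using \<Delta> \<open>0 < C\<close> by simp
    then have D: "0 < D (H (Suc t))" using 1
      by (smt (verit) mult_nonneg_nonneg mult_nonpos_nonneg)
    have "D (H (Suc t)) * (\<kappa> * (\<Delta> (Suc t))\<^sup>2) \<le> D (H (Suc t)) * (H (Suc t) - H (Suc (Suc t)))"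
      using D descent[of "Suc t"] by (intro mult_left_mono) auto
    also have "\<dots> \<le> \<delta>" unfolding \<delta>_def using t pos by (intro concave) auto
    finally have 2: "D (H (Suc t)) * (\<kappa> * (\<Delta> (Suc t))\<^sup>2) \<le> \<delta>" .
    have "\<kappa> * (\<Delta> (Suc t))\<^sup>2 * 1 \<le> \<kappa> * (\<Delta> (Suc t))\<^sup>2 * (D (H (Suc t)) * (C * \<Delta> t))"
      using 1 \<open>0 < \<kappa>\<close> by (intro mult_left_mono) auto
    also have "\<dots> = D (H (Suc t)) * (\<kappa> * (\<Delta> (Suc t))\<^sup>2) * (C * \<Delta> t)" by simp
    also have "\<dots> \<le> \<delta> * (C * \<Delta> t)" using 2 \<open>C * \<Delta> t \<ge> 0\<close> by (intro mult_right_mono)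
    finally have "(\<Delta> (Suc t))\<^sup>2 \<le> \<Delta> t * (C / \<kappa> * \<delta>)"
      using \<open>0 < \<kappa>\<close> by (simp add: field_simps)
    moreover have "0 \<le> \<delta>"
      using 2 D \<open>0 < \<kappa>\<close> by (meson mult_nonneg_nonneg less_imp_le order_trans zero_le_power2)
    then have "0 \<le> C / \<kappa> * \<delta>" using \<open>0 < \<kappa>\<close> \<open>0 < C\<close> by simp
    ultimately have "\<Delta> (Suc t) \<le> (\<Delta> t + C / \<kappa> * \<delta>) / 2"
      using arith_geo_mean_sqrt[OF \<Delta>[of t]] real_le_rsqrt by (meson order_trans)
    then show ?thesis by (simp add: \<delta>_def add_divide_distrib)
  qed
  \<comment> \<open>Up to \<open>\<Delta> t\<close>, the sum of steps on the right is bounded by the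
    one on the left, so its half moves over and doubles the constant. The \<open>\<phi>\<close>
    terms telescope and the last is dropped by nonnegativity.\<close>
  have part: "(\<Sum>k<n. \<Delta> (k + Suc t)) \<le> \<Delta> t + C / \<kappa> * \<phi> (H (Suc t))" if t: "T \<le> t" for t n
  proof -
    have "(\<Sum>k<n. \<Delta> (k + Suc t)) \<le> (\<Sum>k<n. \<Delta> (k + t)) / 2
        + C / (2 * \<kappa>) * (\<phi> (H (Suc t)) - \<phi> (H (n + Suc t)))" for n
    proof (induction n)
      case (Suc n)
      then show ?case using step[of "n + t"] t by (simp add: algebra_simps add_divide_distrib)
    qed simp
    moreover have "C / (2 * \<kappa>) * (\<phi> (H (Suc t)) - \<phi> (H (n + Suc t))) \<le> C / (2 * \<kappa>) * \<phi> (H (Suc t))"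
      using \<phi>[of "n + Suc t"] t \<open>0 < \<kappa>\<close> \<open>0 < C\<close> by (intro mult_left_mono) auto
    moreover have "(\<Sum>k<n. \<Delta> (k + t)) \<le> (\<Sum>k<Suc n. \<Delta> (k + t))" using \<Delta> by simp
    moreover have "(\<Sum>k<Suc n. \<Delta> (k + t)) = \<Delta> t + (\<Sum>k<n. \<Delta> (k + Suc t))"
      by (subst sum.lessThan_Suc_shift) simp
    ultimately have "(\<Sum>k<n. \<Delta> (k + Suc t)) \<le> (\<Delta> t + (\<Sum>k<n. \<Delta> (k + Suc t))) / 2
        + C / (2 * \<kappa>) * \<phi> (H (Suc t))"
      by (smt (verit) divide_right_mono)
    then show ?thesis by (simp add: field_simps)
  qed
  have sm: "summable (\<lambda>k. \<Delta> (k + Suc T))"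
    by (rule summableI_nonneg_bounded[OF \<Delta> part]) simp
  then show summ: "summable \<Delta>" by (subst (asm) summable_iff_shift)
  show "(\<Sum>k. \<Delta> (k + Suc t)) \<le> \<Delta> t + C / \<kappa> * \<phi> (H (Suc t))" if "T \<le> t" for t
    using summ part[OF that] by (intro suminf_le_const) (auto simp: summable_iff_shift simp del: add_Suc_right)
qed

lemma summable_steps_convergent:
  fixes x :: "nat \<Rightarrow> 'a::banach"
  assumes "summable (\<lambda>t. norm (x (Suc t) - x t))"
  shows "\<exists>l. x \<longlonglongrightarrow> l \<and> (\<forall>t. norm (x t - l) \<le> (\<Sum>k. norm (x (Suc (k + t)) - x (k + t))))"
proof -
  have "summable (\<lambda>t. x (Suc t) - x t)" using assms by (rule summable_norm_cancel)
  then have "convergent (\<lambda>n. \<Sum>t<n. x (Suc t) - x t)" by (simp add: summable_iff_convergent)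
  then have "convergent (\<lambda>n. x n - x 0)" by (simp add: sum_lessThan_telescope)
  then obtain l0 where "(\<lambda>n. x n - x 0) \<longlonglongrightarrow> l0" unfolding convergent_def by blast
  then have "(\<lambda>n. x n - x 0 + x 0) \<longlonglongrightarrow> l0 + x 0" by (intro tendsto_intros)
  then have l: "x \<longlonglongrightarrow> l0 + x 0" by simp
  have "norm (x t - (l0 + x 0)) \<le> (\<Sum>k. norm (x (Suc (k + t)) - x (k + t)))" for t
  proof (rule LIMSEQ_le_const2)
    show "(\<lambda>n. norm (x t - x (n + t))) \<longlonglongrightarrow> norm (x t - (l0 + x 0))"
      by (intro tendsto_intros LIMSEQ_ignore_initial_segment l)
    have sm: "summable (\<lambda>k. norm (x (Suc (k + t)) - x (k + t)))"
      using summable_ignore_initial_segment[OF assms, of t] by simp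
    have "norm (x t - x (n + t)) \<le> (\<Sum>k<n. norm (x (Suc (k + t)) - x (k + t)))" for n
    proof -
      have "(\<Sum>k<n. x (Suc (k + t)) - x (k + t)) = x (n + t) - x t"
        using sum_lessThan_telescope[of "\<lambda>k. x (k + t)" n] by simp
      then have "norm (x t - x (n + t)) = norm (\<Sum>k<n. x (Suc (k + t)) - x (k + t))"
        by (simp add: norm_minus_commute)
      then show ?thesis by (simp add: norm_sum)
    qed
    also have "(\<Sum>k<n. norm (x (Suc (k + t)) - x (k + t))) \<le> (\<Sum>k. norm (x (Suc (k + t)) - x (k + t)))" for n
      using sm by (intro sum_le_suminf) auto
    finally show "\<exists>N. \<forall>n\<ge>N. norm (x t - x (n + t)) \<le> (\<Sum>k. norm (x (Suc (k + t)) - x (k + t)))"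
      by blast
  qed
  then show ?thesis using l by blast
qed

text \<open>Solving the recursion for \<open>S (Suc t)\<close> gives the contraction factor
  \<open>M / (1 + M)\<close>.\<close>

lemma linear_rate:
  fixes S :: "nat \<Rightarrow> real"
  assumes "0 < M" and S: "\<And>t. 0 \<le> S t" and rec: "\<And>t. T \<le> t \<Longrightarrow> S (Suc t) \<le> M * (S t - S (Suc t))"
  shows "\<exists>a0 a1. 0 < a0 \<and> a0 < 1 \<and> 0 < a1 \<and> (\<forall>t\<ge>T. S t \<le> a1 * a0 ^ t)"
proof -
  define q where "q = M / (1 + M)"
  have q: "0 < q" "q < 1" using \<open>0 < M\<close> by (auto simp: q_def)
  have step: "S (Suc t) \<le> q * S t" if "T \<le> t" for t
    using rec[OF that] \<open>0 < M\<close> by (simp add: q_def field_simps)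
  have "S t \<le> (S T / q ^ T + 1) * q ^ t" if "T \<le> t" for t
    using that
  proof (induction t rule: dec_induct)
    case base
    then show ?case using q by (simp add: field_simps)
  next
    case (step t)
    have "S (Suc t) \<le> q * S t" using step by (intro \<open>\<And>t. T \<le> t \<Longrightarrow> S (Suc t) \<le> q * S t\<close>)
    also have "\<dots> \<le> q * ((S T / q ^ T + 1) * q ^ t)" using step q by (intro mult_left_mono) auto
    finally show ?case by (simp add: mult.left_commute)
  qed
  moreover have "0 < S T / q ^ T + 1" using S[of T] q by (simp add: add_nonneg_pos)
  ultimately show ?thesis using q by blast
qed

lemma powr_neg_diff_le:
  fixes p t :: real
  assumes "0 < p" "0 < t"
  shows "t powr (- p) - (t + 1) powr (- p) \<le> p * t powr (- p - 1)"
proof -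
  have "\<exists>z. t < z \<and> z < t + 1 \<and>
      (t + 1) powr (- p) - t powr (- p) = (t + 1 - t) * (- p * z powr (- p - 1))"
    using assms by (intro MVT2) (auto intro!: derivative_eq_intros simp: powr_diff)
  then obtain z where z: "t < z" "(t + 1) powr (- p) - t powr (- p) = - p * z powr (- p - 1)" by auto
  have "z powr (- p - 1) \<le> t powr (- p - 1)" using z(1) assms by (intro powr_mono2') auto
  then have "p * z powr (- p - 1) \<le> p * t powr (- p - 1)" using assms by simp
  then show ?thesis using z(2) by simp
qed

text \<open>Comparison with \<open>a * t powr (- p)\<close>, the decay of the differential equation
  \<open>S' = - (S powr \<beta>) / M\<close>. The exponent satisfies
  \<open>p * \<beta> = p + 1\<close>, so both sides of the recursion scale like
  \<open>t powr (- p - 1)\<close>.\<close>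

lemma sublinear_rate:
  fixes S :: "nat \<Rightarrow> real"
  assumes "0 < M" "1 < \<beta>" and S: "\<And>t. 0 \<le> S t"
    and rec: "\<And>t. T \<le> t \<Longrightarrow> S (Suc t) powr \<beta> \<le> M * (S t - S (Suc t))"
  shows "\<exists>a>0. \<forall>t\<ge>max T 1. S t \<le> a * real t powr (- (1 / (\<beta> - 1)))"
proof -
  define p where "p = 1 / (\<beta> - 1)"
  have p: "0 < p" "p * (\<beta> - 1) = 1" "p * \<beta> = p + 1" using \<open>1 < \<beta>\<close> by (auto simp: p_def field_simps)
  define T' where "T' = max T 1"
  \<comment> \<open>The power of 2 pays for replacing \<open>t\<close> by \<open>t + 1\<close>. In
    \<open>a\<close> the three summands serve the induction step
    (\<open>K \<le> a powr (\<beta> - 1)\<close>), the base case and positivity.\<close>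
  define K where "K = M * p * 2 powr (p + 1)"
  define a where "a = K powr p + S T' * real T' powr p + 1"
  have "0 < K" using \<open>0 < M\<close> p by (simp add: K_def)
  have a: "0 < a" using S[of T'] by (simp add: a_def add_nonneg_pos)
  have "(K powr p) powr (\<beta> - 1) \<le> a powr (\<beta> - 1)"
    using S[of T'] \<open>1 < \<beta>\<close> by (intro powr_mono2) (auto simp: a_def)
  then have aK: "K \<le> a powr (\<beta> - 1)" using p(2) \<open>0 < K\<close> by (simp add: powr_powr)
  have "S t \<le> a * real t powr (- p)" if "T' \<le> t" for t
    using that
  proof (induction t rule: dec_induct)
    case base
    have "S T' * real T' powr p \<le> a" by (simp add: a_def)
    then have "S T' * real T' powr p * real T' powr (- p) \<le> a * real T' powr (- p)"
      by (intro mult_right_mono) auto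
    moreover have "real T' > 0" by (simp add: T'_def)
    ultimately show ?case by (simp add: mult.assoc flip: powr_add)
  next
    case (step t)
    then have t: "T \<le> t" "1 \<le> t" by (auto simp: T'_def)
    show ?case
    proof (rule ccontr)
      assume "\<not> ?thesis"
      then have less: "a * (real t + 1) powr (- p) < S (Suc t)" by (simp add: add.commute)
      then have "(a * (real t + 1) powr (- p)) powr \<beta> \<le> S (Suc t) powr \<beta>"
        using a \<open>1 < \<beta>\<close> by (intro powr_mono2) auto
      also have "\<dots> \<le> M * (S t - S (Suc t))" by (rule rec[OF t(1)])
      also have "\<dots> < M * (a * real t powr (- p) - a * (real t + 1) powr (- p))"
        using less step \<open>0 < M\<close> by (intro mult_strict_left_mono) auto
      also have "\<dots> = M * a * (real t powr (- p) - (real t + 1) powr (- p))"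
        by (simp add: right_diff_distrib)
      also have "\<dots> \<le> M * a * (p * real t powr (- p - 1))"
        using \<open>0 < M\<close> a p t by (intro mult_left_mono powr_neg_diff_le) auto
      also have "\<dots> \<le> M * a * (p * (2 powr (p + 1) * (real t + 1) powr (- p - 1)))"
      proof -
        have "(2 * real t) powr (- p - 1) \<le> (real t + 1) powr (- p - 1)"
          using t p by (intro powr_mono2') auto
        then have "2 powr (p + 1) * (2 * real t) powr (- p - 1) \<le> 2 powr (p + 1) * (real t + 1) powr (- p - 1)"
          by (intro mult_left_mono) auto
        moreover have "2 powr (p + 1) * (2 * real t) powr (- p - 1) = real t powr (- p - 1)"
          using t by (simp add: powr_mult flip: powr_add mult.assoc)
        ultimately show ?thesis using \<open>0 < M\<close> a p by (intro mult_left_mono) auto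
      qed
      also have "\<dots> = a * K * (real t + 1) powr (- p - 1)" by (simp add: K_def)
      also have "\<dots> \<le> a * a powr (\<beta> - 1) * (real t + 1) powr (- p - 1)"
        using a aK by (intro mult_right_mono mult_left_mono) auto
      also have "\<dots> = (a * (real t + 1) powr (- p)) powr \<beta>"
      proof -
        have "a * a powr (\<beta> - 1) = a powr \<beta>" using a by (simp add: powr_diff)
        moreover have "- p - 1 = - p * \<beta>" using p(3) by simp
        ultimately show ?thesis using a by (simp add: powr_mult powr_powr)
      qed
      finally show False by simp
    qed
  qed
  then show ?thesis using a unfolding p_def T'_def by blast
qed

text \<open>Steps are differences of the tails \<open>S\<close>. For positive
  \<open>\<alpha>\<close> the KL inequality bounds the gap by a power of the step, and the tail
  estimate becomes \<open>S (Suc t) \<le> \<Delta> t + E * \<Delta> t powr \<theta>\<close> with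
  \<open>\<theta> = (1 - \<alpha>) / \<alpha>\<close>. For steps below 1 the linear term dominates
  when \<open>\<theta> \<ge> 1\<close>, that is when \<open>\<alpha> \<le> 1/2\<close>.\<close>

lemma KL_exponent_rates:
  fixes H \<Delta> S :: "nat \<Rightarrow> real"
  assumes "0 \<le> \<alpha>" "\<alpha> < 1" "0 < a" "0 < C" "0 < \<kappa>"
    and H: "\<And>t. 0 \<le> H t" and \<Delta>: "\<And>t. 0 \<le> \<Delta> t" "summable \<Delta>"
    and descent: "\<And>t. \<kappa> * (\<Delta> t)\<^sup>2 \<le> H t - H (Suc t)"
    and KL: "\<And>t. T \<le> t \<Longrightarrow> 0 < H (Suc t) \<Longrightarrow> 1 \<le> a * (1 - \<alpha>) * H (Suc t) powr (- \<alpha>) * (C * \<Delta> t)"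
    and tail: "\<And>t. T \<le> t \<Longrightarrow> (\<Sum>k. \<Delta> (k + Suc t)) \<le> \<Delta> t + K * (a * H (Suc t) powr (1 - \<alpha>))"
    and "0 < K"
  defines "S \<equiv> \<lambda>t. \<Sum>k. \<Delta> (k + t)"
  shows "\<exists>t0\<ge>1. (\<alpha> = 0 \<longrightarrow> (\<forall>t>t0. S t = 0)) \<and>
      (0 < \<alpha> \<and> \<alpha> \<le> 1/2 \<longrightarrow> (\<exists>a0 a1. 0 < a0 \<and> a0 < 1 \<and> 0 < a1 \<and> (\<forall>t>t0. S t \<le> a1 * a0 ^ t))) \<and>
      (1/2 < \<alpha> \<and> \<alpha> < 1 \<longrightarrow>
        (\<exists>a2>0. \<forall>t>t0. S t \<le> a2 * real t powr (- ((1 - \<alpha>) / (2 * \<alpha> - 1)))))"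
proof -
  have S0: "0 \<le> S t" for t
    unfolding S_def using \<Delta> by (intro suminf_nonneg summable_ignore_initial_segment) auto
  have \<Delta>_eq: "\<Delta> t = S t - S (Suc t)" for t
    unfolding S_def using suminf_split_head[OF summable_ignore_initial_segment[OF \<Delta>(2), of t]] by simp
  have "\<Delta> \<longlonglongrightarrow> 0" by (rule summable_LIMSEQ_zero[OF \<Delta>(2)])
  then have small: "\<exists>N. \<forall>t\<ge>N. \<Delta> t < e" if "e > 0" for e
    using metric_LIMSEQ_D[OF _ that, of \<Delta> 0] \<Delta>(1) by auto
  show ?thesis
  proof (cases "\<alpha> = 0")
    case True
    \<comment> \<open>While the gap is open, exponent zero bounds each step from below by
      \<open>1 / (a * C)\<close>. Steps tend to zero, so the gap closes after finitely many
      iterations.\<close>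
    obtain N where N: "\<And>t. N \<le> t \<Longrightarrow> \<Delta> t < 1 / (a * C)"
      using small[of "1 / (a * C)"] \<open>0 < a\<close> \<open>0 < C\<close> by auto
    have Hz: "H (Suc t) = 0" if "max T N \<le> t" for t
    proof (rule ccontr)
      assume "H (Suc t) \<noteq> 0"
      then have "0 < H (Suc t)" using H[of "Suc t"] by simp
      then have "1 \<le> a * (C * \<Delta> t)" using KL[of t] that True by simp
      then show False using N[of t] that \<open>0 < a\<close> \<open>0 < C\<close> by (simp add: field_simps)
    qed
    have "S t = 0" if "max 1 (Suc (max T N)) < t" for t
    proof -
      have "\<Delta> (k + t) = 0" for k
      proof -
        have "max T N \<le> k + t - 1" "Suc (k + t - 1) = k + t" using that by auto
        then have "H (k + t) = 0" using Hz[of "k + t - 1"] by metis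
        then have "\<kappa> * (\<Delta> (k + t))\<^sup>2 \<le> 0" using descent[of "k + t"] H[of "Suc (k + t)"] by simp
        then show ?thesis using \<open>0 < \<kappa>\<close> by (simp add: mult_le_0_iff)
      qed
      then show ?thesis by (simp add: S_def)
    qed
    then show ?thesis using True by (intro exI[of _ "max 1 (Suc (max T N))"]) auto
  next
    case False
    then have "0 < \<alpha>" using assms(1) by simp
    define \<theta> where "\<theta> = (1 - \<alpha>) / \<alpha>"
    have \<theta>: "0 < \<theta>" "\<alpha> * \<theta> = 1 - \<alpha>" using \<open>0 < \<alpha>\<close> \<open>\<alpha> < 1\<close> by (auto simp: \<theta>_def)
    define B where "B = a * (1 - \<alpha>) * C"
    have "0 < B" using assms by (simp add: B_def)
    have H\<theta>: "H (Suc t) powr (1 - \<alpha>) \<le> B powr \<theta> * \<Delta> t powr \<theta>" if "T \<le> t" for t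
    proof (cases "H (Suc t) = 0")
      case False
      then have pos: "0 < H (Suc t)" using H[of "Suc t"] by simp
      have "H (Suc t) powr \<alpha> * 1 \<le> H (Suc t) powr \<alpha> * (a * (1 - \<alpha>) * H (Suc t) powr (- \<alpha>) * (C * \<Delta> t))"
        using KL[OF that pos] by (intro mult_left_mono) auto
      also have "\<dots> = (H (Suc t) powr \<alpha> * H (Suc t) powr (- \<alpha>)) * (B * \<Delta> t)" by (simp add: B_def)
      also have "H (Suc t) powr \<alpha> * H (Suc t) powr (- \<alpha>) = 1" using pos by (simp flip: powr_add)
      finally have "(H (Suc t) powr \<alpha>) powr \<theta> \<le> (B * \<Delta> t) powr \<theta>"
        using \<theta> by (intro powr_mono2) auto
      then show ?thesis using \<theta>(2) \<open>0 < B\<close> \<Delta>(1)[of t] by (simp add: powr_powr powr_mult)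
    qed simp
    obtain N where N: "\<And>t. N \<le> t \<Longrightarrow> \<Delta> t < 1" using small[of 1] by auto
    define E where "E = K * a * B powr \<theta>"
    have "0 < E" using assms \<open>0 < B\<close> by (simp add: E_def)
    have rec: "S (Suc t) \<le> \<Delta> t + E * \<Delta> t powr \<theta>" if "T \<le> t" for t
    proof -
      have "S (Suc t) \<le> \<Delta> t + K * (a * H (Suc t) powr (1 - \<alpha>))" unfolding S_def by (rule tail[OF that])
      also have "K * (a * H (Suc t) powr (1 - \<alpha>)) \<le> K * (a * (B powr \<theta> * \<Delta> t powr \<theta>))"
        using H\<theta>[OF that] assms by (intro mult_left_mono) auto
      finally show ?thesis by (simp add: E_def mult.assoc)
    qed
    define T1 where "T1 = max 1 (max T N)"
    show ?thesis
    proof (cases "\<alpha> \<le> 1/2")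
      case True
      have "S (Suc t) \<le> (1 + E) * (S t - S (Suc t))" if "T1 \<le> t" for t
      proof -
        have "1 \<le> \<theta>" using True \<open>0 < \<alpha>\<close> by (simp add: \<theta>_def field_simps)
        then have "\<Delta> t powr \<theta> \<le> \<Delta> t powr 1"
          using \<Delta>(1)[of t] N[of t] that by (intro powr_mono') (auto simp: T1_def)
        then have "E * \<Delta> t powr \<theta> \<le> E * \<Delta> t" using \<Delta>(1)[of t] \<open>0 < E\<close> by (simp split: if_splits)
        then show ?thesis using rec[of t] that \<Delta>_eq[of t] by (simp add: T1_def algebra_simps)
      qed
      then obtain a0 a1 where "0 < a0" "a0 < 1" "0 < a1" "\<And>t. T1 \<le> t \<Longrightarrow> S t \<le> a1 * a0 ^ t"
        using linear_rate[of "1 + E" S T1] S0 \<open>0 < E\<close> by (auto simp: add_pos_pos)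
      then have "\<exists>a0 a1. 0 < a0 \<and> a0 < 1 \<and> 0 < a1 \<and> (\<forall>t>T1. S t \<le> a1 * a0 ^ t)"
        by (intro exI[of _ a0] exI[of _ a1]) auto
      then show ?thesis using True False by (intro exI[of _ T1]) (auto simp: T1_def)
    next
      case False
      \<comment> \<open>Raising \<open>S (Suc t) \<le> (1 + E) * \<Delta> t powr \<theta>\<close> to
        the power \<open>1 / \<theta>\<close> makes the right side linear in the difference of
        tails; \<open>\<beta>_exp\<close> translates the resulting rate.\<close>
      define \<beta> where "\<beta> = 1 / \<theta>"
      have "\<theta> < 1" using False by (simp add: \<theta>_def field_simps)
      then have \<beta>: "1 < \<beta>" "\<theta> * \<beta> = 1" using \<theta> by (auto simp: \<beta>_def)
      have \<beta>_exp: "1 / (\<beta> - 1) = (1 - \<alpha>) / (2 * \<alpha> - 1)"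
        using False \<open>\<alpha> < 1\<close> by (simp add: \<beta>_def \<theta>_def field_simps)
      have "S (Suc t) powr \<beta> \<le> (1 + E) powr \<beta> * (S t - S (Suc t))" if "T1 \<le> t" for t
      proof -
        have "\<Delta> t powr 1 \<le> \<Delta> t powr \<theta>"
          using \<Delta>(1)[of t] N[of t] that \<open>\<theta> < 1\<close> by (intro powr_mono') (auto simp: T1_def)
        then have "\<Delta> t \<le> \<Delta> t powr \<theta>" using \<Delta>(1)[of t] by (simp split: if_splits)
        then have "S (Suc t) \<le> (1 + E) * \<Delta> t powr \<theta>"
          using rec[of t] that by (simp add: T1_def algebra_simps)
        then have "S (Suc t) powr \<beta> \<le> ((1 + E) * \<Delta> t powr \<theta>) powr \<beta>"
          using S0 \<beta> by (intro powr_mono2) auto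
        also have "\<dots> = (1 + E) powr \<beta> * \<Delta> t"
          using \<open>0 < E\<close> \<beta>(2) \<Delta>(1)[of t] by (simp add: powr_mult powr_powr)
        finally show ?thesis by (simp add: \<Delta>_eq)
      qed
      then obtain a2 where "0 < a2" "\<And>t. max T1 1 \<le> t \<Longrightarrow> S t \<le> a2 * real t powr (- (1 / (\<beta> - 1)))"
        using sublinear_rate[of "(1 + E) powr \<beta>" \<beta> S T1] S0 \<open>0 < E\<close> \<beta>(1) by auto
      then have "\<exists>a2>0. \<forall>t>T1. S t \<le> a2 * real t powr (- ((1 - \<alpha>) / (2 * \<alpha> - 1)))"
        unfolding \<beta>_exp by (intro exI[of _ a2]) (auto simp: T1_def)
      then show ?thesis using False by (intro exI[of _ T1]) (auto simp: T1_def)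
    qed
  qed
qed

text \<open>The desingularizing derivatives are positive, so their sum dominates the one of
  whichever neighbourhood contains \<open>z\<close>. The common value \<open>\<zeta>\<close> on
  \<open>\<Omega>\<close> lets all of them be evaluated at the same
  \<open>s - \<zeta>\<close>.\<close>

lemma KL_uniform:
  fixes h :: "'a::euclidean_space \<Rightarrow> ereal"
  assumes "compact \<Omega>" and val: "\<And>p. p \<in> \<Omega> \<Longrightarrow> h p = ereal \<zeta>"
    and KL: "\<And>p. p \<in> \<Omega> \<Longrightarrow> KL_with h p (a p) (\<phi> p) (V p)"
  obtains P \<eta> U where "finite P" "P \<subseteq> \<Omega>" "\<Omega> \<noteq> {} \<Longrightarrow> P \<noteq> {}" "0 < \<eta>" "\<And>p. p \<in> P \<Longrightarrow> ereal \<eta> \<le> a p" "open U" "\<Omega> \<subseteq> U"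
    "\<And>z s v. z \<in> U \<Longrightarrow> h z = ereal s \<Longrightarrow> \<zeta> < s \<Longrightarrow> s < \<zeta> + \<eta> \<Longrightarrow> v \<in> lim_subdiff h z \<Longrightarrow>
       1 \<le> (\<Sum>p\<in>P. deriv (\<phi> p) (s - \<zeta>)) * norm v"
proof -
  have V: "open (V p)" "p \<in> V p" "0 < a p" if "p \<in> \<Omega>" for p
    using KL[OF that] by (auto simp: KL_with_def desing_def)
  then have "\<Omega> \<subseteq> (\<Union>p\<in>\<Omega>. V p)" by blast
  then obtain P where P: "P \<subseteq> \<Omega>" "finite P" "\<Omega> \<subseteq> (\<Union>p\<in>P. V p)"
    using compactE_image[OF \<open>compact \<Omega>\<close>, of \<Omega> V] V(1) by blast
  \<comment> \<open>Inserting 1 keeps the minimum meaningful for empty \<open>P\<close>; a real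
    \<open>\<eta>\<close> below it exists even where \<open>a p\<close> is infinite.\<close>
  have "0 < Min (insert 1 (a ` P))" using P V(3) by auto
  then obtain \<eta> where \<eta>: "0 < ereal \<eta>" "ereal \<eta> < Min (insert 1 (a ` P))" using ereal_dense2 by blast
  have \<eta>a: "ereal \<eta> \<le> a p" if "p \<in> P" for p
    using \<eta>(2) that P(2) by (auto intro: less_imp_le)
  have main: "1 \<le> (\<Sum>p\<in>P. deriv (\<phi> p) (s - \<zeta>)) * norm v"
    if z: "z \<in> (\<Union>p\<in>P. V p)" "h z = ereal s" "\<zeta> < s" "s < \<zeta> + \<eta>" "v \<in> lim_subdiff h z" for z s v
  proof -
    obtain p where p: "p \<in> P" "z \<in> V p" using z(1) by blast
    then have p\<Omega>: "p \<in> \<Omega>" using P(1) by blast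
    have "ereal s < ereal \<zeta> + ereal \<eta>" using z by simp
    also have "\<dots> \<le> ereal \<zeta> + a p" using \<eta>a[OF p(1)] by (intro add_left_mono)
    finally have "1 \<le> deriv (\<phi> p) (s - \<zeta>) * norm v"
      using KL[OF p\<Omega>] p z val[OF p\<Omega>] unfolding KL_with_def by fastforce
    also have "\<dots> \<le> (\<Sum>p\<in>P. deriv (\<phi> p) (s - \<zeta>)) * norm v"
    proof (intro mult_right_mono member_le_sum)
      fix p' assume p': "p' \<in> P - {p}"
      then have "desing (a p') (\<phi> p')" using KL P(1) by (auto simp: KL_with_def)
      moreover have "ereal (s - \<zeta>) < a p'"
      proof -
        have "ereal (s - \<zeta>) < ereal \<eta>" using z by simp
        also have "\<dots> \<le> a p'" using \<eta>a p' by simp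
        finally show ?thesis .
      qed
      ultimately show "0 \<le> deriv (\<phi> p') (s - \<zeta>)" using z by (auto simp: desing_def intro: less_imp_le)
    qed (use p P(2) in auto)
    finally show ?thesis .
  qed
  show thesis
  proof (rule that)
    show "0 < \<eta>" using \<eta>(1) by simp
    show "open (\<Union>p\<in>P. V p)" using V(1) P(1) by blast
    show "1 \<le> (\<Sum>p\<in>P. deriv (\<phi> p) (s - \<zeta>)) * norm v"
      if "z \<in> (\<Union>p\<in>P. V p)" "h z = ereal s" "\<zeta> < s" "s < \<zeta> + \<eta>" "v \<in> lim_subdiff h z" for z s v
      using that by (rule main)
  qed (use P \<eta>a in auto)
qed

subsection \<open>Quadratic models\<close>

lemma quadratic_convex:
  fixes a :: "'a::real_inner"
  assumes "0 \<le> k"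
  shows "convex_on UNIV (\<lambda>y. b + inner d (y - a) + k / 2 * (norm (y - a))\<^sup>2)"
proof (rule convex_onI)
  fix t :: real and y z :: 'a assume t: "0 < t" "t < 1"
  define p q where "p = y - a" and "q = z - a"
  have e: "(1 - t) *\<^sub>R y + t *\<^sub>R z - a = (1 - t) *\<^sub>R p + t *\<^sub>R q" by (simp add: p_def q_def algebra_simps)
  have n: "(norm ((1 - t) *\<^sub>R p + t *\<^sub>R q))\<^sup>2 =
      (1 - t) * (norm p)\<^sup>2 + t * (norm q)\<^sup>2 - t * (1 - t) * (norm (p - q))\<^sup>2"
    unfolding power2_norm_eq_inner
    by (simp add: inner_add_left inner_add_right inner_diff_left inner_diff_right inner_commute algebra_simps)
  have "0 \<le> k / 2 * (t * (1 - t) * (norm (p - q))\<^sup>2)" using t assms by simp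
  then show "b + inner d ((1 - t) *\<^sub>R y + t *\<^sub>R z - a) + k / 2 * (norm ((1 - t) *\<^sub>R y + t *\<^sub>R z - a))\<^sup>2
      \<le> (1 - t) * (b + inner d (y - a) + k / 2 * (norm (y - a))\<^sup>2) +
        t * (b + inner d (z - a) + k / 2 * (norm (z - a))\<^sup>2)"
    unfolding e n p_def[symmetric] q_def[symmetric] by (simp add: inner_add_right algebra_simps diff_divide_distrib)
qed simp

lemma quadratic_has_derivative:
  fixes a :: "'a::real_inner"
  shows "((\<lambda>y. b + inner d (y - a) + k / 2 * (norm (y - a))\<^sup>2) has_derivative
           (\<lambda>h. inner (d + k *\<^sub>R (y - a)) h)) (at y)"
  unfolding power2_norm_eq_inner
  by (auto intro!: derivative_eq_intros simp: inner_add_left inner_commute algebra_simps)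

text \<open>In the \<open>y\<close> block the gradient of \<open>g i\<close> cancels against the
  derivative of \<open>z - y\<close>. Thus the \<open>y\<close> and \<open>w\<close> blocks vanish
  at \<open>z = y\<close>, to first and second order, which lets a subgradient of
  \<open>Fbar\<close> be bounded by one step. The transpose is the adjoint of \<open>H\<close> in
  the inner product.\<close>

lemma Gbar_has_derivative:
  fixes g :: "'m::finite \<Rightarrow> real^'n::finite \<Rightarrow> real" and w :: "real^'m"
  assumes "(g i has_derivative (\<lambda>h. inner (dg i y) h)) (at y)"
    and "(dg i has_derivative (\<lambda>h. H *v h)) (at y)"
  shows "((\<lambda>q. Gbar g dg i (fst q) (fst (snd q)) (snd (snd q))) has_derivative
     (\<lambda>h. inner (dg i y + w $ i *\<^sub>R (z - y), transpose H *v (z - y) - w $ i *\<^sub>R (z - y),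
                ((norm (z - y))\<^sup>2 / 2) *\<^sub>R axis i 1) h)) (at (z, y, w))"
proof -
  let ?y = "\<lambda>q::(real^'n) \<times> (real^'n) \<times> (real^'m). fst (snd q)"
  have y': "(?y has_derivative ?y) (at (z, y, w))" by (auto intro!: derivative_eq_intros)
  have g': "((\<lambda>q. g i (?y q)) has_derivative (\<lambda>h. inner (dg i y) (?y h))) (at (z, y, w))"
    using assms(1) by (intro has_derivative_compose[OF y']) simp
  have dg': "((\<lambda>q. dg i (?y q)) has_derivative (\<lambda>h. H *v ?y h)) (at (z, y, w))"
    using assms(2) by (intro has_derivative_compose[OF y']) simp
  have w': "((\<lambda>q::(real^'n) \<times> (real^'n) \<times> (real^'m). snd (snd q) $ i) has_derivative
      (\<lambda>h. snd (snd h) $ i)) (at (z, y, w))"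
    by (intro bounded_linear.has_derivative[OF bounded_linear_vec_nth]) (auto intro!: derivative_eq_intros)
  have adj: "inner (H *v k) d = inner (transpose H *v d) k" for k d
    by (simp add: transpose_matrix_vector dot_lmul_matrix inner_commute[of "H *v k"])
  have d': "((\<lambda>q. fst q - ?y q) has_derivative (\<lambda>h. fst h - ?y h)) (at (z, y, w))"
    by (auto intro!: derivative_eq_intros)
  define e where "e = z - y"
  have n': "((\<lambda>q. inner (fst q - ?y q) (fst q - ?y q)) has_derivative (\<lambda>h. 2 * inner e (fst h - ?y h)))
      (at (z, y, w))"
    using has_derivative_inner[OF d' d'] by (simp add: e_def inner_commute)
  have "((\<lambda>q. g i (?y q) + inner (dg i (?y q)) (fst q - ?y q)
        + snd (snd q) $ i * (1 / 2) * inner (fst q - ?y q) (fst q - ?y q)) has_derivative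
      (\<lambda>h. inner (dg i y) (?y h) + (inner (dg i y) (fst h - ?y h) + inner (H *v ?y h) e)
        + (w $ i * (1 / 2) * (2 * inner e (fst h - ?y h)) + snd (snd h) $ i * (1 / 2) * inner e e)))
      (at (z, y, w))"
    using has_derivative_add[OF has_derivative_add[OF g' has_derivative_inner[OF dg' d']]
        has_derivative_mult[OF has_derivative_mult_left[OF w', of "1 / 2"] n']]
    by (simp add: e_def)
  moreover have "(\<lambda>h. inner (dg i y) (?y h) + (inner (dg i y) (fst h - ?y h) + inner (H *v ?y h) e)
        + (w $ i * (1 / 2) * (2 * inner e (fst h - ?y h)) + snd (snd h) $ i * (1 / 2) * inner e e)) =
      inner (dg i y + w $ i *\<^sub>R e, transpose H *v e - w $ i *\<^sub>R e, ((norm e)\<^sup>2 / 2) *\<^sub>R axis i 1)"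
    by (auto simp: fun_eq_iff adj power2_norm_eq_inner inner_axis' inner_diff_left inner_diff_right
        inner_add_left algebra_simps)
  ultimately show ?thesis by (simp add: Gbar_def power2_norm_eq_inner e_def)
qed

text \<open>A crude entrywise estimate: all that matters is linearity in \<open>norm h\<close> with
  a factor controlled by \<open>norm A\<close>.\<close>

lemma norm_transpose_mult_le:
  fixes A :: "real^'n::finite^'m::finite"
  shows "norm (transpose A *v h) \<le> real CARD('n) * (real CARD('m) * (norm A * norm h))"
proof -
  have "\<bar>(transpose A *v h) $ j\<bar> \<le> real CARD('m) * (norm A * norm h)" for j
  proof -
    have "\<bar>(transpose A *v h) $ j\<bar> \<le> (\<Sum>k\<in>UNIV. \<bar>A $ k $ j * h $ k\<bar>)"
      by (simp add: matrix_vector_mult_def transpose_def sum_abs)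
    also have "\<dots> \<le> (\<Sum>k\<in>(UNIV::'m set). norm A * norm h)"
    proof (rule sum_mono)
      fix k
      have "\<bar>A $ k $ j\<bar> \<le> norm (A $ k)" by (rule component_le_norm_cart)
      also have "\<dots> \<le> norm A" by (rule Finite_Cartesian_Product.norm_nth_le)
      finally show "\<bar>A $ k $ j * h $ k\<bar> \<le> norm A * norm h"
        unfolding abs_mult by (intro mult_mono component_le_norm_cart) auto
    qed
    finally show ?thesis by simp
  qed
  then have "(\<Sum>j\<in>UNIV. \<bar>(transpose A *v h) $ j\<bar>) \<le> (\<Sum>j\<in>(UNIV::'n set). real CARD('m) * (norm A * norm h))"
    by (intro sum_mono)
  then show ?thesis using norm_le_l1_cart[of "transpose A *v h"] by simp
qed

lemma continuous_bounded_on_bounded: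
  fixes h :: "'a::euclidean_space \<Rightarrow> 'b::real_normed_vector"
  assumes "continuous_on UNIV h" "bounded B"
  shows "\<exists>M>0. \<forall>y\<in>B. norm (h y) \<le> M"
proof -
  have "compact (h ` closure B)"
    using assms by (intro compact_continuous_image) (auto intro: continuous_on_subset)
  then have "bounded (h ` closure B)" by (rule compact_imp_bounded)
  then obtain M where "M > 0" "\<forall>y\<in>h ` closure B. norm y \<le> M" unfolding bounded_pos by blast
  then show ?thesis using closure_subset[of B] by blast
qed

subsection \<open>Iterates of the line search\<close>

locale scp_ls =
  fixes f P1 P2 :: "real^'n::finite \<Rightarrow> real"
    and df :: "real^'n \<Rightarrow> real^'n"
    and g :: "'m::finite \<Rightarrow> real^'n \<Rightarrow> real"
    and dg :: "'m \<Rightarrow> real^'n \<Rightarrow> real^'n"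
    and c Llo Lhi \<tau> :: real
    and x \<xi> :: "nat \<Rightarrow> real^'n" and Lf :: "nat \<Rightarrow> real" and Lg :: "nat \<Rightarrow> real^'m"
  assumes f_C1: "\<forall>y. (f has_derivative (\<lambda>h. inner (df y) h)) (at y)" "continuous_on UNIV df"
    and P1_cvx: "convex_on UNIV P1" "continuous_on UNIV P1"
    and P2_cvx: "convex_on UNIV P2" "continuous_on UNIV P2"
    and g_cont: "\<forall>i. continuous_on UNIV (g i)"
    and A: "AssumptionA f df P1 P2 g dg"
    and B: "AssumptionB g dg"
    and C: "AssumptionC g dg"
    and D: "AssumptionD df P1 P2 g dg"
    and alg: "SCP_ls_seq f df P1 P2 g dg c Llo Lhi \<tau> x \<xi> Lf Lg"
begin

definition obj :: "real^'n \<Rightarrow> real" where "obj y = f y + P1 y - P2 y"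

definition model :: "nat \<Rightarrow> real^'n \<Rightarrow> real" where
  "model t y = inner (df (x t) - \<xi> t) (y - x t) + Lf t / 2 * (norm (y - x t))\<^sup>2 + P1 y"

definition \<Delta> :: "nat \<Rightarrow> real" where "\<Delta> t = norm (x (Suc t) - x t)"

text \<open>The newer iterate comes first because it carries the value: \<open>Fbar\<close> at
  \<open>state t\<close> equals \<open>obj (x (Suc t))\<close>.\<close>

definition state :: "nat \<Rightarrow> (real^'n) \<times> (real^'n) \<times> (real^'m)" where
  "state t = (x (Suc t), x t, Lg t)"

lemma params: "0 < c" "0 < Llo" "Llo < Lhi" "1 < \<tau>"
  using alg by (auto simp: SCP_ls_seq_def)

lemma f_deriv: "(f has_derivative (\<lambda>h. inner (df y) h)) (at y)"
  using f_C1(1) by blast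

lemma g_deriv: "(g i has_derivative (\<lambda>h. inner (dg i y) h)) (at y)"
  using B by (auto simp: AssumptionB_def)

lemma dg_cont: "continuous_on UNIV (dg i)"
  using B by (auto simp: AssumptionB_def)

lemma obj_cont: "continuous_on UNIV obj"
proof -
  have "continuous_on UNIV f"
    using f_deriv by (meson continuous_at_imp_continuous_on has_derivative_continuous)
  then show ?thesis unfolding obj_def[abs_def] using P1_cvx P2_cvx by (intro continuous_intros)
qed

lemma \<Delta>_nonneg: "0 \<le> \<Delta> t" by (simp add: \<Delta>_def)

lemma accept_imp:
  assumes "accept f P1 P2 g c y z" "feasible g y"
  shows "feasible g z" "obj z \<le> obj y - c / 2 * (norm (z - y))\<^sup>2"
  using assms by (auto simp: accept_def Fobj_def obj_def)

lemma x_feasible: "feasible g (x t)"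
  using alg by (cases t) (auto simp: SCP_ls_seq_def accept_def, metis)

lemma x_step:
  "\<xi> t \<in> csubdiff P2 (x t)"
  "subprob_sol df P1 g dg (x t) (\<xi> t) (Lf t) (Lg t) (x (Suc t))"
  "accept f P1 P2 g c (x t) (x (Suc t))"
proof -
  have "\<xi> t \<in> lim_subdiff (\<lambda>y. ereal (P2 y)) (x t)" using alg unfolding SCP_ls_seq_def by blast
  then show "\<xi> t \<in> csubdiff P2 (x t)" using lim_subdiff_convex[OF P2_cvx] by simp
  show "subprob_sol df P1 g dg (x t) (\<xi> t) (Lf t) (Lg t) (x (Suc t))"
    "accept f P1 P2 g c (x t) (x (Suc t))"
    using alg unfolding SCP_ls_seq_def by (metis order_refl)+
qed

lemma Gbar_x_Suc: "Gbar g dg i (x (Suc t)) (x t) (Lg t) \<le> 0"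
  using x_step(2) by (auto simp: subprob_sol_def)

lemma descent: "c / 2 * (\<Delta> t)\<^sup>2 \<le> obj (x t) - obj (x (Suc t))"
  using accept_imp(2)[OF x_step(3)[of t] x_feasible] by (simp add: \<Delta>_def)

section \<open>Bounds on the line search moduli\<close>

lemma df_Lipschitz: "\<exists>L\<ge>0. \<forall>y z. norm (df y - df z) \<le> L * norm (y - z)"
proof -
  obtain L where L: "\<And>y z. norm (df y - df z) \<le> L * norm (y - z)"
    using A unfolding AssumptionA_def by blast
  have "norm (df y - df z) \<le> \<bar>L\<bar> * norm (y - z)" for y z
    using L[of y z] by (smt (verit) mult_right_mono norm_ge_zero)
  then show ?thesis by (intro exI[of _ "\<bar>L\<bar>"]) simp
qed

lemma dg_Lipschitz: "\<exists>L. \<forall>i y z. norm (dg i y - dg i z) \<le> L * norm (y - z)"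
proof -
  have "\<forall>i. \<exists>L. \<forall>y z. norm (dg i y - dg i z) \<le> L * norm (y - z)"
    using A unfolding AssumptionA_def by blast
  then obtain L where L: "\<And>i y z. norm (dg i y - dg i z) \<le> L i * norm (y - z)" by metis
  have "norm (dg i y - dg i z) \<le> Max (range L) * norm (y - z)" for i y z
  proof -
    have "L i * norm (y - z) \<le> Max (range L) * norm (y - z)" by (intro mult_right_mono) auto
    then show ?thesis using L[of i y z] by linarith
  qed
  then show ?thesis by blast
qed

text \<open>The trial point is compared with \<open>y\<close>, which is feasible for its own
  subproblem. The descent lemma bounds \<open>f\<close> above and the subgradient bounds
  \<open>P2\<close> below, leaving a decrease with factor \<open>(lf - L) / 2\<close>; hence the
  threshold \<open>L + c\<close>.\<close>

lemma large_modulus_accepted: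
  assumes L: "\<And>y z. norm (df y - df z) \<le> L * norm (y - z)"
    and xi: "s \<in> csubdiff P2 y" and sol: "subprob_sol df P1 g dg y s lf lg z"
    and "feasible g y" "feasible g z" "L + c \<le> lf"
  shows "accept f P1 P2 g c y z"
proof -
  have "\<forall>i. Gbar g dg i y y lg \<le> 0" using \<open>feasible g y\<close> by (simp add: Gbar_def feasible_def)
  then have "inner (df y - s) (z - y) + lf / 2 * (norm (z - y))\<^sup>2 + P1 z
      \<le> inner (df y - s) (y - y) + lf / 2 * (norm (y - y))\<^sup>2 + P1 y"
    using sol unfolding subprob_sol_def by blast
  moreover have "f z \<le> f y + inner (df y) (z - y) + L / 2 * (norm (z - y))\<^sup>2"
    by (rule Lipschitz_gradient_descent[OF f_deriv L])
  moreover have "P2 y + inner s (z - y) \<le> P2 z" using xi by (simp add: csubdiff_def)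
  moreover have "(L + c) / 2 * (norm (z - y))\<^sup>2 \<le> lf / 2 * (norm (z - y))\<^sup>2"
    using \<open>L + c \<le> lf\<close> by (intro mult_right_mono) auto
  ultimately have "f z + P1 z - P2 z \<le> f y + P1 y - P2 y - c / 2 * (norm (z - y))\<^sup>2"
    by (simp add: inner_diff_left algebra_simps add_divide_distrib)
  then show ?thesis using assms by (simp add: accept_def Fobj_def)
qed

text \<open>A rejected modulus lies below its acceptance threshold, so after one multiplication it
  is at most \<open>\<tau>\<close> times that threshold. This gives \<open>WF\<close> and
  \<open>WG\<close>, the other entries of the maxima covering the initial choice.\<close>

lemma moduli_bounded:
  "\<exists>W>0. \<forall>t. 0 < Lf t \<and> Lf t \<le> W \<and> (\<forall>i. 0 < Lg t $ i \<and> Lg t $ i \<le> W)"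
proof -
  obtain L where L: "0 \<le> L" "\<And>y z. norm (df y - df z) \<le> L * norm (y - z)"
    using df_Lipschitz by blast
  obtain G where G: "\<And>i y z. norm (dg i y - dg i z) \<le> G * norm (y - z)"
    using dg_Lipschitz by blast
  define WF where "WF = max Lhi (\<tau> * (L + c))"
  define WG where "WG = max 1 (\<tau> * (G / Llo))"
  have bound: "Llo \<le> Lf t \<and> Lf t \<le> WF \<and> (\<forall>i. Llo \<le> Lg t $ i \<and> Lg t $ i \<le> WG * Lhi)" for t
  proof -
    obtain K LF LG Z where
      init: "LF 0 \<in> {Llo..Lhi}" "\<And>i. LG 0 $ i \<in> {Llo..Lhi}" and
      sol: "\<And>k. k \<le> K \<Longrightarrow> subprob_sol df P1 g dg (x t) (\<xi> t) (LF k) (LG k) (Z k)" and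
      rej: "\<And>k. k < K \<Longrightarrow> \<not> accept f P1 P2 g c (x t) (Z k)" and
      upd: "\<And>k. k < K \<Longrightarrow> if \<not> feasible g (Z k) then LG (Suc k) = \<tau> *\<^sub>R LG k \<and> LF (Suc k) = LF k
               else LF (Suc k) = \<tau> * LF k \<and> LG (Suc k) = LG k" and
      fin: "Lf t = LF K" "Lg t = LG K"
      using alg unfolding SCP_ls_seq_def by metis
    \<comment> \<open>The constraint moduli are scaled together, so \<open>LG k\<close> stays a
      multiple of \<open>LG 0\<close>. Bounding the scalar \<open>s\<close> controls all components
      at once, whichever constraint caused the rejection.\<close>
    have "Llo \<le> LF k \<and> LF k \<le> WF \<and> (\<exists>s. 1 \<le> s \<and> s \<le> WG \<and> LG k = s *\<^sub>R LG 0)" if "k \<le> K" for k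
      using that
    proof (induction k)
      case 0
      then show ?case using init(1) by (auto simp: WF_def WG_def intro!: exI[of _ 1])
    next
      case (Suc k)
      then have k: "k < K" by simp
      obtain s where s: "1 \<le> s" "s \<le> WG" "LG k = s *\<^sub>R LG 0" and lf: "Llo \<le> LF k" "LF k \<le> WF"
        using Suc by auto
      show ?case
      proof (cases "feasible g (Z k)")
        case True
        have "LF k < L + c"
          using large_modulus_accepted[OF L(2) x_step(1) sol x_feasible True] rej[OF k] k by fastforce
        then have "\<tau> * LF k \<le> \<tau> * (L + c)" using params by simp
        moreover have "Llo \<le> \<tau> * LF k"
          using lf params mult_mono[of 1 \<tau> Llo "LF k"] by simp
        ultimately show ?thesis using upd[OF k] True s by (auto simp: WF_def)
      next
        case False
        \<comment> \<open>Otherwise every constraint modulus would be at least \<open>G\<close>,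
          making \<open>Gbar\<close> a majorant of each \<open>g i\<close>, and the trial point
          would be feasible.\<close>
        have "s * Llo < G"
        proof (rule ccontr)
          assume "\<not> s * Llo < G"
          have "g i (Z k) \<le> 0" for i
          proof -
            have "G \<le> s * Llo" using \<open>\<not> s * Llo < G\<close> by simp
            also have "\<dots> \<le> s * LG 0 $ i" using s init(2)[of i] by (intro mult_left_mono) auto
            finally have "G / 2 * (norm (Z k - x t))\<^sup>2 \<le> LG k $ i / 2 * (norm (Z k - x t))\<^sup>2"
              using s by (intro mult_right_mono) auto
            moreover have "g i (Z k) \<le> g i (x t) + inner (dg i (x t)) (Z k - x t) + G / 2 * (norm (Z k - x t))\<^sup>2"
              by (rule Lipschitz_gradient_descent[OF g_deriv G])
            moreover have "Gbar g dg i (Z k) (x t) (LG k) \<le> 0"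
              using sol[of k] k by (auto simp: subprob_sol_def)
            ultimately show ?thesis by (simp add: Gbar_def)
          qed
          then show False using False by (simp add: feasible_def)
        qed
        then have "s \<le> G / Llo" using params by (simp add: field_simps)
        then have "\<tau> * s \<le> \<tau> * (G / Llo)" using params by (intro mult_left_mono) auto
        then have "\<tau> * s \<le> WG" by (simp add: WG_def)
        moreover have "1 \<le> \<tau> * s" using s params mult_mono[of 1 \<tau> 1 s] by simp
        moreover have "LG (Suc k) = (\<tau> * s) *\<^sub>R LG 0" using upd[OF k] False s by simp
        ultimately show ?thesis using upd[OF k] False lf by auto
      qed
    qed
    from this[of K] obtain s where s: "1 \<le> s" "s \<le> WG" "LG K = s *\<^sub>R LG 0" "Llo \<le> LF K" "LF K \<le> WF"
      by auto
    have "Llo \<le> s * LG 0 $ i \<and> s * LG 0 $ i \<le> WG * Lhi" for i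
    proof -
      have "1 * Llo \<le> s * LG 0 $ i" "s * LG 0 $ i \<le> WG * Lhi"
        using s init(2)[of i] params by (intro mult_mono; auto)+
      then show ?thesis by simp
    qed
    then show ?thesis using s fin by simp
  qed
  have "0 < max WF (WG * Lhi)" using params by (simp add: WF_def less_max_iff_disj)
  moreover have "0 < Lf t \<and> Lf t \<le> max WF (WG * Lhi)" for t
    using bound[of t] params by (simp add: le_max_iff_disj)
  moreover have "0 < Lg t $ i \<and> Lg t $ i \<le> max WF (WG * Lhi)" for t i
    using bound[of t] params by (auto simp: le_max_iff_disj intro: less_le_trans)
  ultimately show ?thesis by blast
qed

section \<open>Consequences of sufficient decrease\<close>

lemma obj_decreasing: "obj (x (Suc t)) \<le> obj (x t)"
  using descent[of t] params(1) by (smt (verit) mult_nonneg_nonneg zero_le_power2 divide_nonneg_nonneg)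

lemma x_bounded: "bounded (range x)"
proof -
  have "Fobj f P1 P2 g (x t) \<le> ereal (obj (x 0))" for t
    using decseqD[of "\<lambda>t. obj (x t)" 0 t] obj_decreasing x_feasible[of t]
    by (auto simp: Fobj_def obj_def decseq_Suc_iff)
  then have "range x \<subseteq> {y. Fobj f P1 P2 g y \<le> ereal (obj (x 0))}" by auto
  moreover have "bounded {y. Fobj f P1 P2 g y \<le> ereal (obj (x 0))}"
    using A unfolding AssumptionA_def by blast
  ultimately show ?thesis using bounded_subset by blast
qed

lemma obj_convergent: obtains \<zeta> where "(\<lambda>t. obj (x t)) \<longlonglongrightarrow> \<zeta>" "\<And>t. \<zeta> \<le> obj (x t)"
proof -
  obtain M where M: "\<And>t. norm (obj (x t)) \<le> M"
    using continuous_bounded_on_bounded[OF obj_cont x_bounded] by auto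
  have dec: "decseq (\<lambda>t. obj (x t))" using obj_decreasing by (simp add: decseq_Suc_iff)
  obtain \<zeta> where \<zeta>: "(\<lambda>t. obj (x t)) \<longlonglongrightarrow> \<zeta>"
    using decseq_convergent[OF dec, of "- M"] M by (metis abs_le_D2 minus_le_iff real_norm_def)
  then show thesis using decseq_ge[OF dec \<zeta>] by (intro that)
qed

lemma \<Delta>_null: "\<Delta> \<longlonglongrightarrow> 0"
proof -
  obtain \<zeta> where \<zeta>: "(\<lambda>t. obj (x t)) \<longlonglongrightarrow> \<zeta>" using obj_convergent .
  have "(\<lambda>t. 2 / c * (obj (x t) - obj (x (Suc t)))) \<longlonglongrightarrow> 2 / c * (\<zeta> - \<zeta>)"
    using \<zeta> by (intro tendsto_intros LIMSEQ_Suc)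
  moreover have "(\<Delta> t)\<^sup>2 \<le> 2 / c * (obj (x t) - obj (x (Suc t)))" for t
    using descent[of t] params(1) by (simp add: field_simps)
  ultimately have "(\<lambda>t. (\<Delta> t)\<^sup>2) \<longlonglongrightarrow> 0"
    by (intro tendsto_sandwich[OF _ _ tendsto_const, of 0 "\<lambda>t. (\<Delta> t)\<^sup>2"]) auto
  then have "(\<lambda>t. sqrt ((\<Delta> t)\<^sup>2)) \<longlonglongrightarrow> sqrt 0" by (intro tendsto_intros)
  then show ?thesis using \<Delta>_nonneg by simp
qed

section \<open>Multipliers of the subproblem: existence and uniform bound\<close>

lemma \<xi>_bounded: obtains M where "0 < M" "\<And>t. norm (df (x t) - \<xi> t) \<le> M" "\<And>t. norm (\<xi> t) \<le> M"
proof -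
  obtain M1 where M1: "M1 > 0" "\<And>t. norm (df (x t)) \<le> M1"
    using continuous_bounded_on_bounded[OF f_C1(2) x_bounded] by auto
  obtain M2 where M2: "\<And>t. norm (\<xi> t) \<le> M2"
    using csubdiff_bounded[OF P2_cvx(2) x_bounded] x_step(1) by blast
  show thesis
  proof (rule that[of "M1 + M2"])
    show "norm (df (x t) - \<xi> t) \<le> M1 + M2" for t
      using M1(2)[of t] M2[of t] norm_triangle_ineq4[of "df (x t)" "\<xi> t"] by linarith
    show "norm (\<xi> t) \<le> M1 + M2" for t using M1(1) M2[of t] by linarith
    show "0 < M1 + M2" using M1(1) M2[of 0] norm_ge_zero[of "\<xi> 0"] by linarith
  qed
qed

text \<open>A short multiple of the MFCQ direction works: for active constraints the linear term
  beats the quadratic one, for inactive ones continuity suffices. With \<open>W\<close> an upper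
  bound for the moduli, one direction serves all the models at \<open>p\<close>.\<close>

lemma MFCQ_direction:
  assumes "feasible g p"
  shows "\<exists>d. \<forall>i. g i p + inner (dg i p) d + W / 2 * (norm d)\<^sup>2 < 0"
proof -
  obtain d where d: "\<And>i. g i p = 0 \<Longrightarrow> inner (dg i p) d < 0"
    using B assms unfolding AssumptionB_def by blast
  have "\<forall>\<^sub>F s in at_right (0::real). g i p + s * (inner (dg i p) d + W / 2 * s * (norm d)\<^sup>2) < 0" for i
  proof (cases "g i p = 0")
    case True
    have "((\<lambda>s. inner (dg i p) d + W / 2 * s * (norm d)\<^sup>2) \<longlongrightarrow> inner (dg i p) d + W / 2 * 0 * (norm d)\<^sup>2)
        (at_right 0)"
      by (intro tendsto_intros)
    then have "\<forall>\<^sub>F s in at_right 0. inner (dg i p) d + W / 2 * s * (norm d)\<^sup>2 < 0"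
      using d[OF True] by (intro order_tendstoD(2)[where a = 0]) auto
    moreover have "\<forall>\<^sub>F s in at_right (0::real). 0 < s" by (rule eventually_at_right_less)
    ultimately show ?thesis by eventually_elim (simp add: True mult_pos_neg)
  next
    case False
    have "((\<lambda>s. g i p + s * (inner (dg i p) d + W / 2 * s * (norm d)\<^sup>2)) \<longlongrightarrow>
        g i p + 0 * (inner (dg i p) d + W / 2 * 0 * (norm d)\<^sup>2)) (at_right 0)"
      by (intro tendsto_intros)
    then show ?thesis using False assms by (intro order_tendstoD(2)[where a = 0]) (auto simp: feasible_def less_le)
  qed
  then have "\<forall>\<^sub>F s in at_right (0::real). \<forall>i. g i p + s * (inner (dg i p) d + W / 2 * s * (norm d)\<^sup>2) < 0"
    by (intro eventually_all_finite)
  then obtain s where s: "\<And>i. g i p + s * (inner (dg i p) d + W / 2 * s * (norm d)\<^sup>2) < 0"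
    using eventually_happens'[OF trivial_limit_at_right_real] by blast
  have "g i p + inner (dg i p) (s *\<^sub>R d) + W / 2 * (norm (s *\<^sub>R d))\<^sup>2 < 0" for i
    using s[of i] by (simp add: power_mult_distrib power2_eq_square algebra_simps)
  then show ?thesis by blast
qed

lemma model_convex: "convex_on UNIV (model t)"
proof -
  obtain W where W: "0 < W" "\<And>t. 0 < Lf t \<and> Lf t \<le> W" "\<And>t i. 0 < Lg t $ i \<and> Lg t $ i \<le> W"
    using moduli_bounded by blast
  then have "convex_on UNIV (\<lambda>y. 0 + inner (df (x t) - \<xi> t) (y - x t) + Lf t / 2 * (norm (y - x t))\<^sup>2)"
    by (intro quadratic_convex) (simp add: less_imp_le)
  then have "convex_on UNIV (\<lambda>y. (0 + inner (df (x t) - \<xi> t) (y - x t) + Lf t / 2 * (norm (y - x t))\<^sup>2) + P1 y)"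
    using P1_cvx(1) by (rule convex_on_add)
  then show ?thesis by (simp add: model_def[abs_def])
qed

text \<open>The Lagrangian condition is kept as a global inequality rather than a gradient equation:
  it yields a subgradient of \<open>P1\<close> and can also be tested at a Slater point.\<close>

definition multiplier :: "nat \<Rightarrow> real^'m \<Rightarrow> bool" where
  "multiplier t l \<longleftrightarrow> (\<forall>i. 0 \<le> l $ i \<and> l $ i * Gbar g dg i (x (Suc t)) (x t) (Lg t) = 0) \<and>
     (\<forall>y. model t (x (Suc t)) \<le> model t y + (\<Sum>i\<in>UNIV. l $ i * Gbar g dg i y (x t) (Lg t)))"

text \<open>The subgradient of \<open>P1\<close> at \<open>x (Suc t)\<close> obtained by solving the
  stationarity equation of the Lagrangian.\<close>

definition P1_subgrad :: "nat \<Rightarrow> real^'m \<Rightarrow> real^'n" where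
  "P1_subgrad t l = - (df (x t) - \<xi> t + Lf t *\<^sub>R (x (Suc t) - x t)
      + (\<Sum>i\<in>UNIV. l $ i *\<^sub>R (dg i (x t) + Lg t $ i *\<^sub>R (x (Suc t) - x t))))"

lemma multiplier_exists: "\<exists>l. multiplier t l"
proof -
  obtain W where "0 < W" "\<And>t. 0 < Lf t \<and> Lf t \<le> W" and W: "\<And>t i. 0 < Lg t $ i \<and> Lg t $ i \<le> W"
    using moduli_bounded by blast
  obtain d where d: "\<And>i. g i (x t) + inner (dg i (x t)) d + W / 2 * (norm d)\<^sup>2 < 0"
    using MFCQ_direction[OF x_feasible] by blast
  have "\<exists>l::'m \<Rightarrow> real. (\<forall>i. 0 \<le> l i \<and> l i * Gbar g dg i (x (Suc t)) (x t) (Lg t) = 0) \<and>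
      (\<forall>y. model t (x (Suc t)) \<le> model t y + (\<Sum>i\<in>UNIV. l i * Gbar g dg i y (x t) (Lg t)))"
  proof (rule lagrange_multipliers)
    show "convex_on UNIV (\<lambda>y. Gbar g dg i y (x t) (Lg t))" for i
      unfolding Gbar_def by (intro quadratic_convex) (simp add: W less_imp_le)
    show "model t (x (Suc t)) \<le> model t y" if "\<And>i. Gbar g dg i y (x t) (Lg t) \<le> 0" for y
      using x_step(2)[of t] that unfolding subprob_sol_def model_def by blast
    show "Gbar g dg i (x t + d) (x t) (Lg t) < 0" for i
    proof -
      have "Lg t $ i / 2 * (norm d)\<^sup>2 \<le> W / 2 * (norm d)\<^sup>2"
        using W[of t i] by (intro mult_right_mono) auto
      then show ?thesis using d[of i] by (simp add: Gbar_def)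
    qed
  qed (use model_convex Gbar_x_Suc in auto)
  then obtain l :: "'m \<Rightarrow> real" where "(\<forall>i. 0 \<le> l i \<and> l i * Gbar g dg i (x (Suc t)) (x t) (Lg t) = 0) \<and>
      (\<forall>y. model t (x (Suc t)) \<le> model t y + (\<Sum>i\<in>UNIV. l i * Gbar g dg i y (x t) (Lg t)))" by blast
  then have "multiplier t (\<chi> i. l i)" by (simp add: multiplier_def)
  then show ?thesis ..
qed

text \<open>Subtracting the smooth part \<open>q\<close> of the Lagrangian from its minimal value
  gives a smooth minorant of \<open>P1\<close> touching it at \<open>x (Suc t)\<close>, by
  complementary slackness.\<close>

lemma P1_subgrad:
  assumes "multiplier t l"
  shows "P1_subgrad t l \<in> csubdiff P1 (x (Suc t))"
proof -
  define q where "q y = 0 + inner (df (x t) - \<xi> t) (y - x t) + Lf t / 2 * (norm (y - x t))\<^sup>2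
      + (\<Sum>i\<in>UNIV. l $ i * Gbar g dg i y (x t) (Lg t))" for y
  have "((\<lambda>y. \<Sum>i\<in>UNIV. l $ i * Gbar g dg i y (x t) (Lg t)) has_derivative
      (\<lambda>h. \<Sum>i\<in>UNIV. l $ i * inner (dg i (x t) + Lg t $ i *\<^sub>R (x (Suc t) - x t)) h)) (at (x (Suc t)))"
    unfolding Gbar_def by (intro has_derivative_sum has_derivative_mult_right quadratic_has_derivative)
  from has_derivative_add[OF quadratic_has_derivative this,
      of 0 "df (x t) - \<xi> t" "x t" "Lf t"]
  have "(q has_derivative (\<lambda>h. inner (df (x t) - \<xi> t + Lf t *\<^sub>R (x (Suc t) - x t)) h +
      (\<Sum>i\<in>UNIV. l $ i * inner (dg i (x t) + Lg t $ i *\<^sub>R (x (Suc t) - x t)) h))) (at (x (Suc t)))"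
    unfolding q_def[abs_def] .
  then have q': "(q has_derivative (\<lambda>h. inner (- P1_subgrad t l) h)) (at (x (Suc t)))"
    by (rule has_derivative_eq_rhs) (simp add: P1_subgrad_def fun_eq_iff inner_add_left inner_sum_left inner_diff_left)
  have q_Suc: "q (x (Suc t)) + P1 (x (Suc t)) = model t (x (Suc t))"
  proof -
    have "l $ i * Gbar g dg i (x (Suc t)) (x t) (Lg t) = 0" for i
      using assms unfolding multiplier_def by blast
    then show ?thesis by (simp only: q_def model_def sum.neutral_const)
  qed
  have "P1_subgrad t l \<in> frechet_subdiff (\<lambda>y. ereal (P1 y)) (x (Suc t))"
  proof (rule smooth_minorant_frechet_subdiff[where \<Phi> = "\<lambda>y. model t (x (Suc t)) - q y"])
    show "((\<lambda>y. model t (x (Suc t)) - q y) has_derivative (\<lambda>h. inner (P1_subgrad t l) h)) (at (x (Suc t)))"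
      by (rule has_derivative_eq_rhs[OF has_derivative_diff[OF has_derivative_const q']]) (simp add: fun_eq_iff)
    show "ereal (model t (x (Suc t)) - q y) \<le> ereal (P1 y)" for y
    proof -
      have "model t (x (Suc t)) \<le> q y + P1 y"
        using assms unfolding multiplier_def by (simp add: q_def model_def algebra_simps)
      then show ?thesis by simp
    qed
  qed (use q_Suc in simp)
  then show ?thesis using frechet_subdiff_convex[OF P1_cvx(1)] by blast
qed

lemma cluster_point_feasible:
  assumes "cluster_point x p"
  shows "feasible g p"
proof -
  obtain r where r: "(x \<circ> r) \<longlonglongrightarrow> p" using assms by (auto simp: cluster_point_def)
  have "g i p \<le> 0" for i
  proof (rule LIMSEQ_le_const2)
    show "(\<lambda>k. g i (x (r k))) \<longlonglongrightarrow> g i p"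
      using g_cont r by (intro continuous_on_tendsto_compose[of UNIV "g i"]) (auto simp: o_def)
  qed (use x_feasible in \<open>auto simp: feasible_def\<close>)
  then show ?thesis by (simp add: feasible_def)
qed

text \<open>Near \<open>p\<close> a single direction \<open>d\<close> makes every model constraint
  at \<open>x t + d\<close> at most \<open>- \<delta>\<close>. The multiplier inequality tested
  there bounds \<open>\<delta>\<close> times the sum of multipliers by a difference of model
  values.\<close>

lemma multipliers_bounded: "\<exists>M T. \<forall>t\<ge>T. \<forall>l. multiplier t l \<longrightarrow> (\<Sum>i\<in>UNIV. l $ i) \<le> M"
proof (rule local_bound_at_cluster_points[OF x_bounded])
  fix p assume p: "cluster_point x p"
  obtain W where W: "0 < W" "\<And>t. 0 < Lf t \<and> Lf t \<le> W" "\<And>t i. 0 < Lg t $ i \<and> Lg t $ i \<le> W"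
    using moduli_bounded by blast
  define \<psi> where "\<psi> d i y = g i y + inner (dg i y) d + W / 2 * (norm d)\<^sup>2" for d i y
  obtain d where d: "\<And>i. \<psi> d i p < 0"
    using MFCQ_direction[OF cluster_point_feasible[OF p]] unfolding \<psi>_def by blast
  \<comment> \<open>Half of the smallest slack at \<open>p\<close>, so that the strict inequality
    persists for nearby \<open>x t\<close>.\<close>
  define \<delta> where "\<delta> = Min (range (\<lambda>i. - \<psi> d i p / 2))"
  have "0 < \<delta>" using d by (auto simp: \<delta>_def)
  have \<delta>: "\<psi> d i p < - \<delta>" for i
  proof -
    have "\<delta> \<le> - \<psi> d i p / 2" by (auto simp: \<delta>_def)
    then show ?thesis using d[of i] by linarith
  qed
  have "\<forall>\<^sub>F y in nhds p. \<psi> d i y < - \<delta>" for i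
  proof (rule order_tendstoD(2)[OF _ \<delta>])
    have "continuous_on UNIV (\<psi> d i)" unfolding \<psi>_def[abs_def]
      using g_cont dg_cont by (intro continuous_intros) auto
    then show "(\<psi> d i \<longlongrightarrow> \<psi> d i p) (nhds p)"
      by (simp add: continuous_on_eq_continuous_at isCont_def flip: tendsto_at_iff_tendsto_nhds)
  qed
  then have "\<forall>\<^sub>F y in nhds p. \<forall>i. \<psi> d i y < - \<delta>" by (rule eventually_all_finite)
  then obtain r where r: "r > 0" "\<And>y i. dist y p < r \<Longrightarrow> \<psi> d i y < - \<delta>"
    unfolding eventually_nhds_metric by blast
  obtain R where R: "\<And>t. norm (x t) \<le> R" using x_bounded by (auto simp: bounded_iff)
  obtain S where S: "S > 0" "\<And>y. norm y \<le> R + norm d \<Longrightarrow> \<bar>P1 y\<bar> \<le> S"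
    using continuous_bounded_on_bounded[OF P1_cvx(2) bounded_cball[of 0 "R + norm d"]] by auto
  obtain X where X: "0 < X" "\<And>t. norm (df (x t) - \<xi> t) \<le> X" "\<And>t. norm (\<xi> t) \<le> X"
    using \<xi>_bounded by blast
  \<comment> \<open>The numerator bounds the model above at \<open>x t + d\<close> and below at
    \<open>x (Suc t)\<close>, where the step is at most \<open>2 * R\<close>.\<close>
  define M where "M = (X * norm d + W / 2 * (norm d)\<^sup>2 + 2 * S + X * (2 * R)) / \<delta>"
  have "(\<Sum>i\<in>UNIV. l $ i) \<le> M" if t: "dist (x t) p < r" and l: "multiplier t l" for t l
  proof -
    have "l $ i * Gbar g dg i (x t + d) (x t) (Lg t) \<le> l $ i * (- \<delta>)" for i
    proof (rule mult_left_mono)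
      have "Lg t $ i / 2 * (norm d)\<^sup>2 \<le> W / 2 * (norm d)\<^sup>2"
        using W(3)[of t i] by (intro mult_right_mono) auto
      then show "Gbar g dg i (x t + d) (x t) (Lg t) \<le> - \<delta>"
        using r(2)[OF t, of i] by (simp add: Gbar_def \<psi>_def)
    qed (use l in \<open>auto simp: multiplier_def\<close>)
    then have "(\<Sum>i\<in>UNIV. l $ i * Gbar g dg i (x t + d) (x t) (Lg t)) \<le> (\<Sum>i\<in>UNIV. l $ i * (- \<delta>))"
      by (intro sum_mono)
    moreover have "model t (x (Suc t)) \<le> model t (x t + d) + (\<Sum>i\<in>UNIV. l $ i * Gbar g dg i (x t + d) (x t) (Lg t))"
      using l unfolding multiplier_def by blast
    ultimately have 1: "\<delta> * (\<Sum>i\<in>UNIV. l $ i) \<le> model t (x t + d) - model t (x (Suc t))"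
      by (simp add: sum_distrib_left mult.commute sum_negf)
    have in_le: "\<bar>inner (df (x t) - \<xi> t) v\<bar> \<le> X * norm v" for v
      using Cauchy_Schwarz_ineq2[of "df (x t) - \<xi> t" v] mult_right_mono[OF X(2)[of t], of "norm v"] by simp
    have 2: "model t (x t + d) \<le> X * norm d + W / 2 * (norm d)\<^sup>2 + S"
    proof -
      have "norm (x t + d) \<le> R + norm d" using norm_triangle_ineq[of "x t" d] R[of t] by linarith
      then have "P1 (x t + d) \<le> S" using S(2) by (simp add: abs_le_iff)
      moreover have "Lf t / 2 * (norm d)\<^sup>2 \<le> W / 2 * (norm d)\<^sup>2"
        using W(2)[of t] by (intro mult_right_mono) auto
      ultimately show ?thesis using in_le[of d] by (simp add: model_def abs_le_iff)
    qed
    have 3: "- (X * (2 * R)) - S \<le> model t (x (Suc t))"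
    proof -
      have "norm (x (Suc t) - x t) \<le> 2 * R"
        using norm_triangle_ineq4[of "x (Suc t)" "x t"] R[of t] R[of "Suc t"] by linarith
      then have "X * norm (x (Suc t) - x t) \<le> X * (2 * R)" using X(1) by simp
      moreover have "- S \<le> P1 (x (Suc t))" using S(2)[of "x (Suc t)"] R[of "Suc t"]
        by (simp add: abs_le_iff) (smt (verit) norm_ge_zero)
      moreover have "0 \<le> Lf t / 2 * (norm (x (Suc t) - x t))\<^sup>2" using W(2)[of t] by simp
      ultimately show ?thesis using in_le[of "x (Suc t) - x t"] by (simp add: model_def abs_le_iff)
    qed
    show ?thesis using 1 2 3 \<open>0 < \<delta>\<close> by (simp add: M_def field_simps)
  qed
  then show "\<exists>C T. \<exists>r>0. \<forall>t\<ge>T. dist (x t) p < r \<longrightarrow> (\<forall>l. multiplier t l \<longrightarrow> (\<Sum>i\<in>UNIV. l $ i) \<le> C)"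
    using r(1) by blast
qed (auto intro: order_trans)

section \<open>Stationarity of cluster points\<close>

lemma bounded_scale_step_null:
  assumes "\<And>t. \<bar>a t\<bar> \<le> W"
  shows "(\<lambda>t. a t *\<^sub>R (x (Suc t) - x t)) \<longlonglongrightarrow> 0"
proof (rule Lim_null_comparison)
  show "\<forall>\<^sub>F t in sequentially. norm (a t *\<^sub>R (x (Suc t) - x t)) \<le> W * \<Delta> t"
    using assms by (intro always_eventually) (auto simp: \<Delta>_def intro: mult_right_mono)
  show "(\<lambda>t. W * \<Delta> t) \<longlonglongrightarrow> 0" using tendsto_mult_right_zero[OF \<Delta>_null] .
qed

text \<open>Multipliers and \<open>\<xi>\<close> are bounded, hence converge along a further
  subsequence. The moduli may oscillate, but they occur only multiplied by a step that tends to
  zero.\<close>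

lemma cluster_point_stationary:
  assumes "cluster_point x p"
  shows "stationary df P1 P2 g dg p"
proof -
  obtain W where W: "0 < W" "\<And>t. 0 < Lf t \<and> Lf t \<le> W" "\<And>t i. 0 < Lg t $ i \<and> Lg t $ i \<le> W"
    using moduli_bounded by blast
  obtain l where l: "\<And>t. multiplier t (l t)" using multiplier_exists by metis
  obtain M T where M: "\<And>t. T \<le> t \<Longrightarrow> (\<Sum>i\<in>UNIV. l t $ i) \<le> M" using multipliers_bounded l by blast
  obtain X where X: "0 < X" "\<And>t. norm (df (x t) - \<xi> t) \<le> X" "\<And>t. norm (\<xi> t) \<le> X"
    using \<xi>_bounded by blast
  obtain r where r: "strict_mono r" "(x \<circ> r) \<longlonglongrightarrow> p" using assms by (auto simp: cluster_point_def)
  \<comment> \<open>The shift by \<open>T\<close> puts every index into the range where multipliers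
    are bounded.\<close>
  define r' where "r' k = r (k + T)" for k
  have r': "strict_mono r'" "T \<le> r' k" for k
    using r(1) seq_suble[OF r(1), of "k + T"] by (auto simp: r'_def strict_mono_def)
  have "norm (l (r' k), \<xi> (r' k)) \<le> M + X" for k
  proof -
    have "norm (l (r' k)) \<le> (\<Sum>i\<in>UNIV. \<bar>l (r' k) $ i\<bar>)" by (rule norm_le_l1_cart)
    also have "\<dots> = (\<Sum>i\<in>UNIV. l (r' k) $ i)" using l[of "r' k"] by (simp add: multiplier_def)
    also have "\<dots> \<le> M" using M r'(2) by blast
    finally show ?thesis using X(3)[of "r' k"] norm_Pair_le[of "l (r' k)" "\<xi> (r' k)"] by linarith
  qed
  then have "bounded (range (\<lambda>k. (l (r' k), \<xi> (r' k))))" by (auto simp: bounded_iff)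
  then obtain L s where s: "strict_mono s" "((\<lambda>k. (l (r' k), \<xi> (r' k))) \<circ> s) \<longlonglongrightarrow> L"
    using bounded_imp_convergent_subsequence by blast
  obtain ls xs where L: "L = (ls, xs)" by (cases L)
  define q where "q k = r' (s k)" for k
  have q: "strict_mono q" using r'(1) s(1) by (simp add: q_def strict_mono_def)
  have sub: "(\<lambda>k. h (q k)) \<longlonglongrightarrow> y" if "h \<longlonglongrightarrow> y" for h :: "nat \<Rightarrow> 'z::topological_space" and y
    using LIMSEQ_subseq_LIMSEQ[OF that q] by (simp add: o_def)
  have lim_l: "(\<lambda>k. l (q k)) \<longlonglongrightarrow> ls" and lim_\<xi>: "(\<lambda>k. \<xi> (q k)) \<longlonglongrightarrow> xs"
    using tendsto_fst[OF s(2)] tendsto_snd[OF s(2)] by (auto simp: L q_def o_def)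
  have lim_x: "(\<lambda>k. x (q k)) \<longlonglongrightarrow> p"
  proof -
    have "strict_mono (\<lambda>k. s k + T)" using s(1) by (simp add: strict_mono_def)
    from LIMSEQ_subseq_LIMSEQ[OF r(2) this] show ?thesis by (simp add: q_def r'_def o_def)
  qed
  have step0: "(\<lambda>t. x (Suc t) - x t) \<longlonglongrightarrow> 0" using bounded_scale_step_null[of "\<lambda>_. 1" 1] by simp
  have "(\<lambda>k. x (q k) + (x (Suc (q k)) - x (q k))) \<longlonglongrightarrow> p + 0"
    by (intro tendsto_add lim_x sub[OF step0])
  then have lim_Suc: "(\<lambda>k. x (Suc (q k))) \<longlonglongrightarrow> p" by simp
  have lim_Lf: "(\<lambda>t. Lf t *\<^sub>R (x (Suc t) - x t)) \<longlonglongrightarrow> 0"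
    using W(2) by (intro bounded_scale_step_null[of _ W]) (simp add: less_imp_le abs_of_pos)
  have lim_Lg: "(\<lambda>t. Lg t $ i *\<^sub>R (x (Suc t) - x t)) \<longlonglongrightarrow> 0" for i
    using W(3) by (intro bounded_scale_step_null[of _ W]) (simp add: less_imp_le abs_of_pos)
  have comp: "(\<lambda>k. h (x (q k))) \<longlonglongrightarrow> h p" if "continuous_on UNIV h" for h :: "real^'n \<Rightarrow> 'z::topological_space"
    using continuous_on_tendsto_compose[OF that lim_x] by auto
  have "(\<lambda>k. P1_subgrad (q k) (l (q k))) \<longlonglongrightarrow>
      - (df p - xs + 0 + (\<Sum>i\<in>UNIV. ls $ i *\<^sub>R (dg i p + 0)))"
    unfolding P1_subgrad_def
    by (intro tendsto_intros comp[OF f_C1(2)] comp[OF dg_cont] lim_\<xi> lim_l sub[OF lim_Lf] sub[OF lim_Lg])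
  then have u: "- (df p - xs + 0 + (\<Sum>i\<in>UNIV. ls $ i *\<^sub>R (dg i p + 0))) \<in> csubdiff P1 p"
    by (rule csubdiff_limit[OF P1_cvx(2) lim_Suc]) (rule P1_subgrad[OF l])
  have xs: "xs \<in> csubdiff P2 p"
    by (rule csubdiff_limit[OF P2_cvx(2) lim_x lim_\<xi>]) (rule x_step(1))
  have ls0: "0 \<le> ls $ i" for i
  proof (rule LIMSEQ_le_const)
    show "(\<lambda>k. l (q k) $ i) \<longlonglongrightarrow> ls $ i" by (intro tendsto_intros lim_l)
  qed (use l in \<open>auto simp: multiplier_def\<close>)
  \<comment> \<open>Slackness holds for \<open>Gbar\<close> along the iterates; its linear and
    quadratic terms vanish in the limit, leaving slackness for \<open>g\<close> at
    \<open>p\<close>.\<close>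
  have compl: "ls $ i * g i p = 0" for i
  proof -
    have "(\<lambda>k. inner (Lg (q k) $ i *\<^sub>R (x (Suc (q k)) - x (q k))) (x (Suc (q k)) - x (q k))) \<longlonglongrightarrow> inner (0::real^'n) 0"
      using sub[OF lim_Lg[of i]] sub[OF step0] by (rule tendsto_inner)
    moreover have "(\<lambda>k. inner (dg i (x (q k))) (x (Suc (q k)) - x (q k))) \<longlonglongrightarrow> inner (dg i p) 0"
      using comp[OF dg_cont[of i]] sub[OF step0] by (rule tendsto_inner)
    moreover have "(\<lambda>k. g i (x (q k))) \<longlonglongrightarrow> g i p" using g_cont by (intro comp) blast
    moreover have "(\<lambda>k. l (q k) $ i) \<longlonglongrightarrow> ls $ i" by (intro tendsto_intros lim_l)
    ultimately have "(\<lambda>k. l (q k) $ i * (g i (x (q k)) + inner (dg i (x (q k))) (x (Suc (q k)) - x (q k))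
        + 1 / 2 * inner (Lg (q k) $ i *\<^sub>R (x (Suc (q k)) - x (q k))) (x (Suc (q k)) - x (q k))))
      \<longlonglongrightarrow> ls $ i * (g i p + inner (dg i p) 0 + 1 / 2 * inner (0::real^'n) 0)"
      by (intro tendsto_mult tendsto_add tendsto_const)
    moreover have "l (q k) $ i * (g i (x (q k)) + inner (dg i (x (q k))) (x (Suc (q k)) - x (q k))
        + 1 / 2 * inner (Lg (q k) $ i *\<^sub>R (x (Suc (q k)) - x (q k))) (x (Suc (q k)) - x (q k))) = 0" for k
      using l[of "q k"] by (simp add: multiplier_def Gbar_def power2_norm_eq_inner)
    ultimately have "(\<lambda>k::nat. 0) \<longlonglongrightarrow> ls $ i * (g i p + inner (dg i p) 0 + 1 / 2 * inner (0::real^'n) 0)"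
      by (simp only:)
    then show ?thesis by (simp add: LIMSEQ_const_iff)
  qed
  show ?thesis unfolding stationary_def
  proof (intro conjI exI[of _ "\<lambda>i. ls $ i"])
    show "feasible g p" by (rule cluster_point_feasible[OF assms])
    show "\<forall>i. 0 \<le> ls $ i \<and> ls $ i * g i p = 0" using ls0 compl by blast
    show "\<exists>u\<in>lim_subdiff (\<lambda>y. ereal (P1 y)) p. \<exists>w\<in>lim_subdiff (\<lambda>y. ereal (P2 y)) p.
        df p + u - w + (\<Sum>i\<in>UNIV. ls $ i *\<^sub>R dg i p) = 0"
      using u xs csubdiff_subset_lim_subdiff
      by (intro bexI[of _ "- (df p - xs + 0 + (\<Sum>i\<in>UNIV. ls $ i *\<^sub>R (dg i p + 0)))"] bexI[of _ xs]) auto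
  qed
qed

section \<open>Subgradients of \<open>Fbar\<close> at the states\<close>

abbreviation Fb :: "(real^'n) \<times> (real^'n) \<times> (real^'m) \<Rightarrow> ereal" where
  "Fb \<equiv> Fbar f P1 P2 g dg"

text \<open>Cluster points are stationary and so lie in \<open>\<Gamma>\<close>. Close to one of
  them both consecutive iterates are in \<open>\<Gamma>\<close>, where \<open>\<xi> t\<close> is the
  gradient at \<open>x t\<close>, and the local Lipschitz bound compares it with the gradient at
  \<open>x (Suc t)\<close>.\<close>

lemma P2_gradient_Lipschitz:
  "\<exists>dP2 L T. \<forall>t\<ge>T. (P2 has_derivative (\<lambda>h. inner (dP2 (x (Suc t))) h)) (at (x (Suc t))) \<and>
     norm (dP2 (x (Suc t)) - \<xi> t) \<le> L * \<Delta> t"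
proof -
  obtain \<Gamma> dP2 where \<Gamma>: "open \<Gamma>" "{y. stationary df P1 P2 g dg y} \<subseteq> \<Gamma>"
    and dP2: "\<And>y. y \<in> \<Gamma> \<Longrightarrow> (P2 has_derivative (\<lambda>h. inner (dP2 y) h)) (at y)"
    and lip: "\<And>p. p \<in> \<Gamma> \<Longrightarrow> \<exists>r>0. \<exists>L. \<forall>y\<in>ball p r \<inter> \<Gamma>. \<forall>z\<in>ball p r \<inter> \<Gamma>.
            norm (dP2 y - dP2 z) \<le> L * norm (y - z)"
    using D unfolding AssumptionD_def by metis
  have "\<exists>L T. \<forall>t\<ge>T. (P2 has_derivative (\<lambda>h. inner (dP2 (x (Suc t))) h)) (at (x (Suc t))) \<and>
     norm (dP2 (x (Suc t)) - \<xi> t) \<le> L * \<Delta> t"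
  proof (rule local_bound_at_cluster_points[OF x_bounded])
    fix p assume "cluster_point x p"
    then have p: "p \<in> \<Gamma>" using cluster_point_stationary \<Gamma>(2) by blast
    obtain r1 where r1: "r1 > 0" "ball p r1 \<subseteq> \<Gamma>" using \<Gamma>(1) p by (meson openE)
    obtain r2 L where r2: "r2 > 0" "\<And>y z. y \<in> ball p r2 \<inter> \<Gamma> \<Longrightarrow> z \<in> ball p r2 \<inter> \<Gamma> \<Longrightarrow>
        norm (dP2 y - dP2 z) \<le> L * norm (y - z)" using lip[OF p] by blast
    define r where "r = min r1 r2"
    have r: "r > 0" using r1 r2 by (simp add: r_def)
    \<comment> \<open>Steps below \<open>r / 2\<close> keep \<open>x (Suc t)\<close> in the ball of
      radius \<open>r\<close> whenever \<open>x t\<close> is within \<open>r / 2\<close> of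
      \<open>p\<close>.\<close>
    obtain T where T: "\<And>t. T \<le> t \<Longrightarrow> \<Delta> t < r / 2"
      using metric_LIMSEQ_D[OF \<Delta>_null, of "r / 2"] r by (auto simp: \<Delta>_nonneg)
    have "(P2 has_derivative (\<lambda>h. inner (dP2 (x (Suc t))) h)) (at (x (Suc t))) \<and>
      norm (dP2 (x (Suc t)) - \<xi> t) \<le> L * \<Delta> t" if "T \<le> t" "dist (x t) p < r / 2" for t
    proof -
      have "dist (x (Suc t)) p < r"
        using dist_triangle[of "x (Suc t)" p "x t"] T[OF that(1)] that(2) by (simp add: \<Delta>_def dist_norm)
      then have S: "x (Suc t) \<in> ball p r2 \<inter> \<Gamma>" "x t \<in> ball p r2 \<inter> \<Gamma>"
        using that(2) r r1(2) by (auto simp: r_def dist_commute)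
      have "\<xi> t = dP2 (x t)" using csubdiff_gradient[OF dP2 x_step(1)] S(2) by blast
      then show ?thesis using dP2 r2(2)[OF S] S(1) by (simp add: \<Delta>_def)
    qed
    then show "\<exists>L T. \<exists>r>0. \<forall>t\<ge>T. dist (x t) p < r \<longrightarrow>
        (P2 has_derivative (\<lambda>h. inner (dP2 (x (Suc t))) h)) (at (x (Suc t))) \<and>
        norm (dP2 (x (Suc t)) - \<xi> t) \<le> L * \<Delta> t"
      using r by (intro exI[of _ L] exI[of _ T] exI[of _ "r / 2"]) simp
  next
    fix L L' t assume "(P2 has_derivative (\<lambda>h. inner (dP2 (x (Suc t))) h)) (at (x (Suc t))) \<and>
      norm (dP2 (x (Suc t)) - \<xi> t) \<le> L * \<Delta> t" "L \<le> L'"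
    then show "(P2 has_derivative (\<lambda>h. inner (dP2 (x (Suc t))) h)) (at (x (Suc t))) \<and>
      norm (dP2 (x (Suc t)) - \<xi> t) \<le> L' * \<Delta> t"
      using mult_right_mono[of L L' "\<Delta> t"] \<Delta>_nonneg[of t] by auto
  qed
  then show ?thesis by blast
qed

lemma Fb_feasible: "(\<And>i. Gbar g dg i y z w \<le> 0) \<Longrightarrow> Fb (y, z, w) = ereal (obj y)"
  by (simp add: Fbar_def obj_def)

lemma Fb_state: "Fb (state t) = ereal (obj (x (Suc t)))"
  unfolding state_def by (rule Fb_feasible[OF Gbar_x_Suc])

lemma Fb_subgradient: "\<exists>K>0. \<exists>T. \<forall>t\<ge>T. \<exists>v\<in>frechet_subdiff Fb (state t). norm v \<le> K * \<Delta> t"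
proof -
  obtain H where H: "\<And>i y. (dg i has_derivative (\<lambda>h. H i y *v h)) (at y)"
    and H_cont: "\<And>i. continuous_on UNIV (H i :: real^'n \<Rightarrow> real^'n^'n)"
    using C unfolding AssumptionC_def by metis
  have "\<forall>i. \<exists>b. \<forall>t. norm (H i (x t)) \<le> b"
    using continuous_bounded_on_bounded[OF H_cont x_bounded] by blast
  then obtain b where b: "\<And>i t. norm (H i (x t)) \<le> b i" by metis
  define KH where "KH = real CARD('n) * (real CARD('n) * Max (range b))"
  obtain dP2 LP T1 where P2': "\<And>t. T1 \<le> t \<Longrightarrow>
      (P2 has_derivative (\<lambda>h. inner (dP2 (x (Suc t))) h)) (at (x (Suc t)))"
    and LP: "\<And>t. T1 \<le> t \<Longrightarrow> norm (dP2 (x (Suc t)) - \<xi> t) \<le> LP * \<Delta> t"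
    using P2_gradient_Lipschitz by blast
  obtain L where L: "0 \<le> L" "\<And>y z. norm (df y - df z) \<le> L * norm (y - z)" using df_Lipschitz by blast
  obtain W where W: "0 < W" "\<And>t. 0 < Lf t \<and> Lf t \<le> W" "\<And>t i. 0 < Lg t $ i \<and> Lg t $ i \<le> W"
    using moduli_bounded by blast
  obtain M T2 where M: "\<And>t l. T2 \<le> t \<Longrightarrow> multiplier t l \<Longrightarrow> (\<Sum>i\<in>UNIV. l $ i) \<le> M"
    using multipliers_bounded by blast
  obtain R where R: "\<And>t. norm (x t) \<le> R" using x_bounded by (auto simp: bounded_iff)
  define K where "K = L + LP + W + M * (KH + W + R)"
  have main: "\<exists>v\<in>frechet_subdiff Fb (state t). norm v \<le> K * \<Delta> t" if t: "max T1 T2 \<le> t" for t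
  proof -
    obtain l where l: "multiplier t l" using multiplier_exists by blast
    define y z w u where "y = x t" and "z = x (Suc t)" and "w = Lg t" and "u = P1_subgrad t l"
    define A where "A i = (dg i y + w $ i *\<^sub>R (z - y), transpose (H i y) *v (z - y) - w $ i *\<^sub>R (z - y),
        ((norm (z - y))\<^sup>2 / 2) *\<^sub>R axis i (1::real))" for i
    define v where "v = (df z - dP2 z + u, 0, 0) + (\<Sum>i\<in>UNIV. l $ i *\<^sub>R A i)"
    \<comment> \<open>\<open>P1\<close> is replaced by its affine minorant and the indicator by the
      multiplier sum, which is nonpositive on the feasible set of \<open>Gbar\<close> and zero at
      the state. So \<open>\<Phi>\<close> lies below \<open>Fb\<close> with contact there.\<close>
    define \<Phi> where "\<Phi> q = f (fst q) - P2 (fst q) + (P1 z + inner u (fst q - z))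
        + (\<Sum>i\<in>UNIV. l $ i * Gbar g dg i (fst q) (fst (snd q)) (snd (snd q)))"
      for q :: "(real^'n) \<times> (real^'n) \<times> (real^'m)"
    have l0: "0 \<le> l $ i" for i using l by (simp add: multiplier_def)
    have fst': "(fst has_derivative fst) (at (z, y, w))" by (auto intro!: derivative_eq_intros)
    have "(\<Phi> has_derivative (\<lambda>h. inner (df z) (fst h) - inner (dP2 z) (fst h) + (0 + inner u (fst h))
        + (\<Sum>i\<in>UNIV. l $ i * inner (A i) h))) (at (z, y, w))"
      unfolding \<Phi>_def[abs_def]
    proof (intro has_derivative_add has_derivative_diff has_derivative_const has_derivative_sum
        has_derivative_mult_right)
      show "((\<lambda>q. f (fst q)) has_derivative (\<lambda>h. inner (df z) (fst h))) (at (z, y, w))"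
        by (rule has_derivative_compose[OF fst']) (simp add: f_deriv)
      show "((\<lambda>q. P2 (fst q)) has_derivative (\<lambda>h. inner (dP2 z) (fst h))) (at (z, y, w))"
        by (rule has_derivative_compose[OF fst']) (use P2' t in \<open>simp add: z_def\<close>)
      show "((\<lambda>q. inner u (fst q - z)) has_derivative (\<lambda>h. inner u (fst h))) (at (z, y, w))"
        by (auto intro!: derivative_eq_intros)
      show "((\<lambda>q. Gbar g dg i (fst q) (fst (snd q)) (snd (snd q))) has_derivative (\<lambda>h. inner (A i) h))
          (at (z, y, w))" for i
        unfolding A_def by (rule Gbar_has_derivative[OF g_deriv H])
    qed
    moreover have "(\<lambda>h. inner (df z) (fst h) - inner (dP2 z) (fst h) + (0 + inner u (fst h))
        + (\<Sum>i\<in>UNIV. l $ i * inner (A i) h)) = inner v"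
      by (auto simp: fun_eq_iff v_def inner_add_left inner_diff_left inner_sum_left)
    ultimately have \<Phi>': "(\<Phi> has_derivative (\<lambda>h. inner v h)) (at (state t))"
      by (simp add: state_def z_def y_def w_def)
    have "v \<in> frechet_subdiff Fb (state t)"
    proof (rule smooth_minorant_frechet_subdiff[OF _ _ \<Phi>'])
      have "(\<Sum>i\<in>UNIV. l $ i * Gbar g dg i z y w) = 0"
        using l by (intro sum.neutral) (auto simp: multiplier_def z_def y_def w_def)
      then show "Fb (state t) = ereal (\<Phi> (state t))"
        unfolding Fb_state by (simp add: \<Phi>_def state_def obj_def flip: z_def y_def w_def)
      show "ereal (\<Phi> q) \<le> Fb q" for q
      proof (cases "\<forall>i. Gbar g dg i (fst q) (fst (snd q)) (snd (snd q)) \<le> 0")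
        case True
        then have "(\<Sum>i\<in>UNIV. l $ i * Gbar g dg i (fst q) (fst (snd q)) (snd (snd q))) \<le> 0"
          using l0 by (intro sum_nonpos) (simp add: mult_nonneg_nonpos)
        moreover have "P1 z + inner u (fst q - z) \<le> P1 (fst q)"
          using P1_subgrad[OF l] by (simp add: csubdiff_def u_def z_def)
        ultimately have "\<Phi> q \<le> obj (fst q)" by (simp add: \<Phi>_def obj_def)
        then show ?thesis
          using Fb_feasible[of "fst q" "fst (snd q)" "snd (snd q)"] True by simp
      qed (auto simp: Fbar_def split: prod.splits)
    qed
    moreover have "norm v \<le> K * \<Delta> t"
    proof -
      have \<Delta>: "norm (z - y) = \<Delta> t" by (simp add: \<Delta>_def z_def y_def)
      \<comment> \<open>The multiplier terms in \<open>u\<close> cancel those of the gradients of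
        \<open>Gbar\<close>; only differences over one step remain.\<close>
      have "fst v = (df z - df y) - (dP2 z - \<xi> t) - Lf t *\<^sub>R (z - y)"
        by (simp add: v_def fst_sum A_def u_def P1_subgrad_def algebra_simps flip: y_def z_def w_def)
      then have "norm (fst v) \<le> norm (df z - df y) + norm (dP2 z - \<xi> t) + norm (Lf t *\<^sub>R (z - y))"
        by (metis (no_types, lifting) add_right_mono norm_triangle_ineq4 order_trans)
      also have "\<dots> \<le> L * \<Delta> t + LP * \<Delta> t + W * \<Delta> t"
      proof (intro add_mono)
        show "norm (df z - df y) \<le> L * \<Delta> t" using L(2)[of z y] \<Delta> by simp
        show "norm (dP2 z - \<xi> t) \<le> LP * \<Delta> t" using LP t by (simp add: z_def)
        show "norm (Lf t *\<^sub>R (z - y)) \<le> W * \<Delta> t"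
          using W(2)[of t] by (simp add: \<Delta> mult_right_mono \<Delta>_nonneg)
      qed
      finally have 1: "norm (fst v) \<le> (L + LP + W) * \<Delta> t" by (simp add: algebra_simps)
      have A_le: "norm (snd (A i)) \<le> (KH + W + R) * \<Delta> t" for i
      proof -
        have "norm (H i y) \<le> Max (range b)" using b[of i t] by (auto simp: y_def intro: order_trans)
        then have "real CARD('n) * (real CARD('n) * (norm (H i y) * \<Delta> t)) \<le> KH * \<Delta> t"
          using \<Delta>_nonneg[of t] by (simp add: KH_def mult_right_mono)
        then have "norm (transpose (H i y) *v (z - y)) \<le> KH * \<Delta> t"
          using norm_transpose_mult_le[of "H i y" "z - y"] by (simp add: \<Delta>)
        moreover have "norm (w $ i *\<^sub>R (z - y)) \<le> W * \<Delta> t"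
          using W(3)[of t i] by (simp add: w_def \<Delta> mult_right_mono \<Delta>_nonneg)
        moreover have "norm (((norm (z - y))\<^sup>2 / 2) *\<^sub>R (axis i 1 :: real^'m)) \<le> R * \<Delta> t"
        proof -
          \<comment> \<open>Boundedness of the iterates turns the quadratic term of the
            \<open>w\<close> block into a linear one.\<close>
          have "\<Delta> t \<le> 2 * R"
            using norm_triangle_ineq4[of z y] R[of t] R[of "Suc t"] by (simp add: z_def y_def flip: \<Delta>)
          then have "\<Delta> t * \<Delta> t \<le> 2 * R * \<Delta> t" using \<Delta>_nonneg by (intro mult_right_mono)
          then show ?thesis by (simp add: \<Delta> norm_axis_1 power2_eq_square)
        qed
        ultimately show ?thesis
          using norm_triangle_ineq4[of "transpose (H i y) *v (z - y)" "w $ i *\<^sub>R (z - y)"]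
            norm_Pair_le[of "transpose (H i y) *v (z - y) - w $ i *\<^sub>R (z - y)"
              "((norm (z - y))\<^sup>2 / 2) *\<^sub>R (axis i 1 :: real^'m)"]
          by (simp add: A_def algebra_simps)
      qed
      have "0 \<le> (KH + W + R) * \<Delta> t" using A_le norm_ge_zero order_trans by blast
      have "norm (snd v) = norm (\<Sum>i\<in>UNIV. l $ i *\<^sub>R snd (A i))" by (simp add: v_def snd_sum zero_prod_def[symmetric])
      also have "\<dots> \<le> (\<Sum>i\<in>UNIV. l $ i * ((KH + W + R) * \<Delta> t))"
        using l0 A_le by (intro order_trans[OF norm_sum] sum_mono) (simp add: mult_left_mono)
      also have "\<dots> = (\<Sum>i\<in>UNIV. l $ i) * ((KH + W + R) * \<Delta> t)" by (simp add: sum_distrib_right)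
      also have "\<dots> \<le> M * ((KH + W + R) * \<Delta> t)"
        using M[OF _ l] t \<open>0 \<le> (KH + W + R) * \<Delta> t\<close> by (intro mult_right_mono) auto
      finally have "norm (snd v) \<le> M * ((KH + W + R) * \<Delta> t)" .
      then show ?thesis using 1 norm_Pair_le[of "fst v" "snd v"] by (simp add: K_def algebra_simps)
    qed
    ultimately show ?thesis by blast
  qed
  have "\<exists>v\<in>frechet_subdiff Fb (state t). norm v \<le> max 1 K * \<Delta> t" if t: "max T1 T2 \<le> t" for t
  proof -
    have "K * \<Delta> t \<le> max 1 K * \<Delta> t" using \<Delta>_nonneg by (intro mult_right_mono) auto
    then show ?thesis using main[OF t] by (meson order_trans)
  qed
  then show ?thesis by (intro exI[of _ "max 1 K"] conjI exI[of _ "max T1 T2"] allI impI) simp_all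
qed

section \<open>The Kurdyka-Lojasiewicz inequality along the states\<close>

lemma state_bounded: "bounded (range state)"
proof -
  obtain R where R: "\<And>t. norm (x t) \<le> R" using x_bounded by (auto simp: bounded_iff)
  obtain W where W: "\<And>t i. 0 < Lg t $ i \<and> Lg t $ i \<le> W" using moduli_bounded by blast
  have "norm (state t) \<le> R + (R + real CARD('m) * W)" for t
  proof -
    have "norm (Lg t) \<le> (\<Sum>i\<in>UNIV. \<bar>Lg t $ i\<bar>)" by (rule norm_le_l1_cart)
    also have "\<dots> \<le> (\<Sum>i\<in>(UNIV::'m set). W)" using W by (intro sum_mono) (simp add: abs_of_pos)
    finally have "norm (Lg t) \<le> real CARD('m) * W" by simp
    then show ?thesis
      using norm_Pair_le[of "x (Suc t)" "(x t, Lg t)"] norm_Pair_le[of "x t" "Lg t"] R[of t] R[of "Suc t"]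
      by (simp add: state_def)
  qed
  then show ?thesis by (auto simp: bounded_iff)
qed

text \<open>The value depends only on the first block and is the limit of the objective. The
  subgradients at the states tend to zero with the steps, so 0 is a limiting subgradient and
  \<open>KL_function\<close> applies at every cluster point.\<close>

lemma state_cluster_point:
  assumes lim: "(\<lambda>t. obj (x t)) \<longlonglongrightarrow> \<zeta>" and "cluster_point state p"
  shows "Fb p = ereal \<zeta>" "lim_subdiff Fb p \<noteq> {}"
proof -
  obtain r where r: "strict_mono r" "(state \<circ> r) \<longlonglongrightarrow> p" using assms(2) by (auto simp: cluster_point_def)
  obtain y z w where p: "p = (y, z, w)" by (cases p)
  have y: "(\<lambda>k. x (Suc (r k))) \<longlonglongrightarrow> y" and z: "(\<lambda>k. x (r k)) \<longlonglongrightarrow> z" and w: "(\<lambda>k. Lg (r k)) \<longlonglongrightarrow> w"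
    using tendsto_fst[OF r(2)] tendsto_fst[OF tendsto_snd[OF r(2)]] tendsto_snd[OF tendsto_snd[OF r(2)]]
    by (auto simp: p state_def o_def)
  have "(\<lambda>k. obj (x (Suc (r k)))) \<longlonglongrightarrow> obj y"
    using y by (intro continuous_on_tendsto_compose[OF obj_cont]) auto
  moreover have obj_r: "(\<lambda>k. obj (x (Suc (r k)))) \<longlonglongrightarrow> \<zeta>"
    using LIMSEQ_subseq_LIMSEQ[OF LIMSEQ_Suc[OF lim] r(1)] by (simp add: o_def)
  ultimately have "obj y = \<zeta>" by (rule LIMSEQ_unique)
  moreover have "Gbar g dg i y z w \<le> 0" for i
  proof (rule LIMSEQ_le_const2)
    have "(\<lambda>k. g i (x (r k))) \<longlonglongrightarrow> g i z" "(\<lambda>k. dg i (x (r k))) \<longlonglongrightarrow> dg i z"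
      using z g_cont dg_cont
      by (auto intro: continuous_on_tendsto_compose[of UNIV "g i"] continuous_on_tendsto_compose[of UNIV "dg i"])
    then show "(\<lambda>k. Gbar g dg i (x (Suc (r k))) (x (r k)) (Lg (r k))) \<longlonglongrightarrow> Gbar g dg i y z w"
      unfolding Gbar_def using y z w by (intro tendsto_intros) auto
  qed (use Gbar_x_Suc in auto)
  ultimately show Fbp: "Fb p = ereal \<zeta>" unfolding p by (simp add: Fb_feasible)
  obtain K T where "\<And>t. T \<le> t \<Longrightarrow> \<exists>v\<in>frechet_subdiff Fb (state t). norm v \<le> K * \<Delta> t"
    using Fb_subgradient by blast
  then obtain v where v: "\<And>t. T \<le> t \<Longrightarrow> v t \<in> frechet_subdiff Fb (state t)" "\<And>t. T \<le> t \<Longrightarrow> norm (v t) \<le> K * \<Delta> t"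
    by metis
  define q where "q k = r (k + T)" for k
  have "strict_mono (\<lambda>k. k + T)" by (simp add: strict_mono_def)
  then have q: "strict_mono q" "\<And>k. T \<le> q k"
    and q_state: "(\<lambda>k. state (q k)) \<longlonglongrightarrow> p" and q_obj: "(\<lambda>k. obj (x (Suc (q k)))) \<longlonglongrightarrow> \<zeta>"
    using r(1) seq_suble[OF r(1)] LIMSEQ_subseq_LIMSEQ[OF r(2)] LIMSEQ_subseq_LIMSEQ[OF obj_r]
    by (auto simp: q_def strict_mono_def o_def intro: order_trans[OF le_add2])
  have "(\<lambda>k. v (q k)) \<longlonglongrightarrow> 0"
  proof (rule Lim_null_comparison)
    show "\<forall>\<^sub>F k in sequentially. norm (v (q k)) \<le> K * \<Delta> (q k)"
      using v(2) q(2) by (intro always_eventually) blast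
    show "(\<lambda>k. K * \<Delta> (q k)) \<longlonglongrightarrow> 0"
      using tendsto_mult_right_zero[OF LIMSEQ_subseq_LIMSEQ[OF \<Delta>_null q(1)], of K] by (simp add: o_def)
  qed
  moreover have "(\<lambda>k. Fb (state (q k))) \<longlonglongrightarrow> Fb p" using q_obj by (simp add: Fb_state Fbp)
  ultimately have "0 \<in> lim_subdiff Fb p"
    unfolding lim_subdiff_def using q_state v(1) q(2) Fbp
    by (intro CollectI conjI exI[of _ "\<lambda>k. state (q k)"] exI[of _ "\<lambda>k. v (q k)"]) auto
  then show "lim_subdiff Fb p \<noteq> {}" by blast
qed

text \<open>The desingularizing functions are left arbitrary so that the estimate can be applied
  twice: with those of \<open>KL_function\<close> for summability and with powers for the
  rates.\<close>

lemma KL_tail_estimate: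
  assumes lim: "(\<lambda>t. obj (x t)) \<longlonglongrightarrow> \<zeta>" and lower: "\<And>t. \<zeta> \<le> obj (x t)"
    and KL: "\<forall>p. cluster_point state p \<longrightarrow> KL_with Fb p (a p) (\<phi> p) (V p)"
  shows "\<exists>P C T. finite P \<and> P \<noteq> {} \<and> P \<subseteq> {p. cluster_point state p} \<and> 0 < C \<and> summable \<Delta> \<and>
    (\<forall>t\<ge>T. 0 < obj (x (Suc t)) - \<zeta> \<longrightarrow>
       1 \<le> (\<Sum>p\<in>P. deriv (\<phi> p) (obj (x (Suc t)) - \<zeta>)) * (C * \<Delta> t)) \<and>
    (\<forall>t\<ge>T. (\<Sum>k. \<Delta> (k + Suc t)) \<le> \<Delta> t + C / (c / 2) * (\<Sum>p\<in>P. \<phi> p (obj (x (Suc t)) - \<zeta>)))"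
proof -
  let ?\<Omega> = "{p. cluster_point state p}"
  define H where "H t = obj (x t) - \<zeta>" for t
  have H0: "0 \<le> H t" for t using lower by (simp add: H_def)
  have Hdec: "H (Suc t) \<le> H t" for t using obj_decreasing by (simp add: H_def)
  obtain P \<eta> U where P: "finite P" "P \<subseteq> ?\<Omega>" "?\<Omega> \<noteq> {} \<Longrightarrow> P \<noteq> {}" and \<eta>: "0 < \<eta>" "\<And>p. p \<in> P \<Longrightarrow> ereal \<eta> \<le> a p"
    and U: "open U" "?\<Omega> \<subseteq> U"
    and ineq: "\<And>z s v. z \<in> U \<Longrightarrow> Fb z = ereal s \<Longrightarrow> \<zeta> < s \<Longrightarrow> s < \<zeta> + \<eta> \<Longrightarrow> v \<in> lim_subdiff Fb z \<Longrightarrow>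
       1 \<le> (\<Sum>p\<in>P. deriv (\<phi> p) (s - \<zeta>)) * norm v"
    by (rule KL_uniform[of ?\<Omega> Fb \<zeta> a \<phi> V])
      (use bounded_compact_cluster_points[OF state_bounded] state_cluster_point(1)[OF lim] KL in auto)
  obtain T1 where T1: "\<And>t. T1 \<le> t \<Longrightarrow> state t \<in> U"
    using eventually_near_cluster_points[OF state_bounded U(1)] U(2) by blast
  obtain C T2 where C: "0 < C" "\<And>t. T2 \<le> t \<Longrightarrow> \<exists>v\<in>frechet_subdiff Fb (state t). norm v \<le> C * \<Delta> t"
    using Fb_subgradient by blast
  have "H \<longlonglongrightarrow> 0" unfolding H_def[abs_def] using tendsto_diff[OF lim tendsto_const[of \<zeta>]] by simp
  then obtain T3 where T3: "\<And>t. T3 \<le> t \<Longrightarrow> H t < \<eta>"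
    using metric_LIMSEQ_D[of H 0 \<eta>] \<eta>(1) H0 by auto
  define T where "T = max T1 (max T2 T3)"
  have desing: "desing (a p) (\<phi> p)" if "p \<in> P" for p
    using KL P(2) that unfolding KL_with_def by blast
  have below: "ereal (H t) < a p" if "p \<in> P" "T \<le> t" for p t
  proof -
    have "ereal (H t) < ereal \<eta>" using T3 that by (simp add: T_def)
    also have "\<dots> \<le> a p" using \<eta>(2) that by blast
    finally show ?thesis .
  qed
  have KL': "1 \<le> (\<Sum>p\<in>P. deriv (\<phi> p) (H (Suc t))) * (C * \<Delta> t)" if t: "T \<le> t" and pos: "0 < H (Suc t)" for t
  proof -
    obtain v where v: "v \<in> frechet_subdiff Fb (state t)" "norm v \<le> C * \<Delta> t"
      using C(2)[of t] t by (auto simp: T_def)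
    have "1 \<le> (\<Sum>p\<in>P. deriv (\<phi> p) (obj (x (Suc t)) - \<zeta>)) * norm v"
    proof (rule ineq[OF _ Fb_state])
      show "state t \<in> U" using T1 t by (simp add: T_def)
      show "v \<in> lim_subdiff Fb (state t)" using v(1) frechet_subdiff_subset_lim_subdiff by blast
      show "\<zeta> < obj (x (Suc t))" using pos by (simp add: H_def)
      show "obj (x (Suc t)) < \<zeta> + \<eta>" using T3[of "Suc t"] t by (simp add: T_def H_def)
    qed
    also have "\<dots> \<le> (\<Sum>p\<in>P. deriv (\<phi> p) (H (Suc t))) * (C * \<Delta> t)"
      unfolding H_def
    proof (intro mult_left_mono v(2) sum_nonneg)
      fix p assume p: "p \<in> P"
      show "0 \<le> deriv (\<phi> p) (obj (x (Suc t)) - \<zeta>)"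
        using desing[OF p] pos below[OF p, of "Suc t"] t by (auto simp: desing_def H_def intro: less_imp_le)
    qed
    finally show ?thesis .
  qed
  have \<phi>_nonneg: "0 \<le> (\<Sum>p\<in>P. \<phi> p (H t))" if "T \<le> t" for t
    using desing below[OF _ that] H0[of t] by (intro sum_nonneg) (auto simp: desing_def)
  have concave: "(\<Sum>p\<in>P. deriv (\<phi> p) (H t)) * (H t - H (Suc t)) \<le> (\<Sum>p\<in>P. \<phi> p (H t)) - (\<Sum>p\<in>P. \<phi> p (H (Suc t)))"
    if "T \<le> t" "0 < H t" for t
    unfolding sum_distrib_right sum_subtractf[symmetric]
    by (intro sum_mono desing_concave_tangent[OF desing]) (use that below H0 Hdec in auto)
  have desc: "c / 2 * (\<Delta> t)\<^sup>2 \<le> H t - H (Suc t)" for t using descent[of t] by (simp add: H_def)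
  have c2: "0 < c / 2" using params(1) by simp
  note * = KL_recursion_finite_length[where H = H and \<Delta> = \<Delta> and T = T
      and \<phi> = "\<lambda>s. \<Sum>p\<in>P. \<phi> p s" and D = "\<lambda>s. \<Sum>p\<in>P. deriv (\<phi> p) s",
      OF c2 C(1) H0 \<Delta>_nonneg desc KL' \<phi>_nonneg concave]
  \<comment> \<open>Bounded states have a cluster point; nonemptiness makes the summed coefficient
    in the rate argument positive.\<close>
  have "P \<noteq> {}" using P(3) bounded_subseq_cluster_point[OF state_bounded, of "\<lambda>n. n"] by blast
  then show ?thesis
    using P(1,2) C(1) *(1) KL'[unfolded H_def] *(2)[unfolded H_def]
    by (intro exI[of _ P] exI[of _ C] exI[of _ T] conjI allI impI)
qed

theorem convergence_with_rates:
  assumes KL: "KL_function Fb"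
  shows "\<exists>xs. x \<longlonglongrightarrow> xs \<and> stationary df P1 P2 g dg xs \<and>
     (\<forall>\<alpha>. 0 \<le> \<alpha> \<and> \<alpha> < 1 \<and> (\<forall>p. cluster_point state p \<longrightarrow> KL_exp_at Fb p \<alpha>) \<longrightarrow>
        (\<exists>t0::nat. 1 \<le> t0 \<and>
           (\<alpha> = 0 \<longrightarrow> (\<forall>t>t0. x t = xs)) \<and>
           (0 < \<alpha> \<and> \<alpha> \<le> 1/2 \<longrightarrow>
              (\<exists>a0 a1. 0 < a0 \<and> a0 < 1 \<and> 0 < a1 \<and>
                 (\<forall>t>t0. norm (x t - xs) \<le> a1 * a0 ^ t))) \<and>
           (1/2 < \<alpha> \<and> \<alpha> < 1 \<longrightarrow>
              (\<exists>a2>0. \<forall>t>t0. norm (x t - xs) \<le> a2 * real t powr (- ((1 - \<alpha>) / (2 * \<alpha> - 1)))))))"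
proof -
  obtain \<zeta> where \<zeta>: "(\<lambda>t. obj (x t)) \<longlonglongrightarrow> \<zeta>" "\<And>t. \<zeta> \<le> obj (x t)"
    using obj_convergent by blast
  have "KL_at Fb p" if "cluster_point state p" for p
    using KL state_cluster_point(2)[OF \<zeta>(1) that] unfolding KL_function_def by blast
  then obtain a \<phi> V where "\<forall>p. cluster_point state p \<longrightarrow> KL_with Fb p (a p) (\<phi> p) (V p)"
    unfolding KL_at_def by metis
  from KL_tail_estimate[OF \<zeta> this] have summ: "summable \<Delta>" by blast
  then obtain xs where xs: "x \<longlonglongrightarrow> xs" and tail: "\<And>t. norm (x t - xs) \<le> (\<Sum>k. \<Delta> (k + t))"
    using summable_steps_convergent[of x] unfolding \<Delta>_def by blast
  have "cluster_point x xs" unfolding cluster_point_def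
    using xs by (intro exI[of _ "\<lambda>n. n"]) (auto simp: strict_mono_def o_def)
  then have stat: "stationary df P1 P2 g dg xs" by (rule cluster_point_stationary)
  have "\<exists>t0::nat. 1 \<le> t0 \<and>
           (\<alpha> = 0 \<longrightarrow> (\<forall>t>t0. x t = xs)) \<and>
           (0 < \<alpha> \<and> \<alpha> \<le> 1/2 \<longrightarrow>
              (\<exists>a0 a1. 0 < a0 \<and> a0 < 1 \<and> 0 < a1 \<and>
                 (\<forall>t>t0. norm (x t - xs) \<le> a1 * a0 ^ t))) \<and>
           (1/2 < \<alpha> \<and> \<alpha> < 1 \<longrightarrow>
              (\<exists>a2>0. \<forall>t>t0. norm (x t - xs) \<le> a2 * real t powr (- ((1 - \<alpha>) / (2 * \<alpha> - 1)))))"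
    if \<alpha>: "0 \<le> \<alpha>" "\<alpha> < 1" and exp: "\<And>p. cluster_point state p \<Longrightarrow> KL_exp_at Fb p \<alpha>" for \<alpha>
  proof -
    obtain b a V where b: "\<And>p. cluster_point state p \<Longrightarrow> 0 < b p"
      and KLb: "\<forall>p. cluster_point state p \<longrightarrow> KL_with Fb p (a p) (\<lambda>s. b p * s powr (1 - \<alpha>)) (V p)"
      using exp unfolding KL_exp_at_def by metis
    from KL_tail_estimate[OF \<zeta> KLb] obtain P C T where
      PCT: "finite P \<and> P \<noteq> {} \<and> P \<subseteq> {p. cluster_point state p} \<and> 0 < C \<and> summable \<Delta> \<and>
        (\<forall>t\<ge>T. 0 < obj (x (Suc t)) - \<zeta> \<longrightarrow>
          1 \<le> (\<Sum>p\<in>P. deriv (\<lambda>s. b p * s powr (1 - \<alpha>)) (obj (x (Suc t)) - \<zeta>)) * (C * \<Delta> t)) \<and>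
        (\<forall>t\<ge>T. (\<Sum>k. \<Delta> (k + Suc t))
          \<le> \<Delta> t + C / (c / 2) * (\<Sum>p\<in>P. b p * (obj (x (Suc t)) - \<zeta>) powr (1 - \<alpha>)))"
      by (elim exE)
    then have P: "finite P" "P \<noteq> {}" "P \<subseteq> {p. cluster_point state p}" and "0 < C"
      by blast+
    have KLP: "1 \<le> (\<Sum>p\<in>P. deriv (\<lambda>s. b p * s powr (1 - \<alpha>)) (obj (x (Suc t)) - \<zeta>)) * (C * \<Delta> t)"
      if "T \<le> t" "0 < obj (x (Suc t)) - \<zeta>" for t
      using PCT that by blast
    have tailP: "(\<Sum>k. \<Delta> (k + Suc t))
        \<le> \<Delta> t + C / (c / 2) * (\<Sum>p\<in>P. b p * (obj (x (Suc t)) - \<zeta>) powr (1 - \<alpha>))"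
      if "T \<le> t" for t
      using PCT that by blast
    \<comment> \<open>All exponents agree, so the sum over the subcover is again a single power
      function, with coefficient \<open>B\<close>.\<close>
    define B where "B = sum b P"
    have "0 < B" unfolding B_def using P b by (intro sum_pos) auto
    have der: "deriv (\<lambda>s. k * s powr (1 - \<alpha>)) s = k * ((1 - \<alpha>) * s powr (- \<alpha>))" if "0 < s" for k s :: real
      using DERIV_cmult[OF has_real_derivative_powr[OF that, of "1 - \<alpha>"], of k]
      by (intro DERIV_imp_deriv) simp
    have c2: "0 < c / 2" using params(1) by simp
    have rates: "\<exists>t0\<ge>1. (\<alpha> = 0 \<longrightarrow> (\<forall>t>t0. (\<Sum>k. \<Delta> (k + t)) = 0)) \<and>
      (0 < \<alpha> \<and> \<alpha> \<le> 1/2 \<longrightarrow> (\<exists>a0 a1. 0 < a0 \<and> a0 < 1 \<and> 0 < a1 \<and> (\<forall>t>t0. (\<Sum>k. \<Delta> (k + t)) \<le> a1 * a0 ^ t))) \<and>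
      (1/2 < \<alpha> \<and> \<alpha> < 1 \<longrightarrow>
        (\<exists>a2>0. \<forall>t>t0. (\<Sum>k. \<Delta> (k + t)) \<le> a2 * real t powr (- ((1 - \<alpha>) / (2 * \<alpha> - 1)))))"
    proof (rule KL_exponent_rates[OF \<alpha> \<open>0 < B\<close> \<open>0 < C\<close> c2, where H = "\<lambda>t. obj (x t) - \<zeta>"
          and T = T and K = "C / (c / 2)"])
      show "1 \<le> B * (1 - \<alpha>) * (obj (x (Suc t)) - \<zeta>) powr (- \<alpha>) * (C * \<Delta> t)"
        if "T \<le> t" "0 < obj (x (Suc t)) - \<zeta>" for t
        using KLP[OF that] unfolding der[OF that(2)] by (simp add: B_def sum_distrib_right mult.assoc)
      show "(\<Sum>k. \<Delta> (k + Suc t)) \<le> \<Delta> t + C / (c / 2) * (B * (obj (x (Suc t)) - \<zeta>) powr (1 - \<alpha>))"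
        if "T \<le> t" for t
        using tailP[OF that] by (simp add: B_def sum_distrib_right)
    qed (use \<zeta>(2) \<Delta>_nonneg summ descent \<open>0 < C\<close> params(1) in auto)
    then obtain t0 where t0: "1 \<le> t0" "\<alpha> = 0 \<Longrightarrow> \<forall>t>t0. (\<Sum>k. \<Delta> (k + t)) = 0"
      "0 < \<alpha> \<and> \<alpha> \<le> 1/2 \<Longrightarrow> \<exists>a0 a1. 0 < a0 \<and> a0 < 1 \<and> 0 < a1 \<and> (\<forall>t>t0. (\<Sum>k. \<Delta> (k + t)) \<le> a1 * a0 ^ t)"
      "1/2 < \<alpha> \<and> \<alpha> < 1 \<Longrightarrow>
        \<exists>a2>0. \<forall>t>t0. (\<Sum>k. \<Delta> (k + t)) \<le> a2 * real t powr (- ((1 - \<alpha>) / (2 * \<alpha> - 1)))"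
      by blast
    show ?thesis
    proof (intro exI[of _ t0] conjI impI)
      show "\<forall>t>t0. x t = xs" if "\<alpha> = 0"
        using t0(2)[OF that] tail by (metis norm_le_zero_iff right_minus_eq)
    qed (use t0(1) t0(3,4) tail in \<open>(meson order_trans)+\<close>)
  qed
  then show ?thesis using xs stat by blast
qed

end

theorem mainTheorem7:
  fixes f P1 P2 :: "real^'n::finite \<Rightarrow> real"
    and df :: "real^'n \<Rightarrow> real^'n"
    and g :: "'m::finite \<Rightarrow> real^'n \<Rightarrow> real"
    and dg :: "'m \<Rightarrow> real^'n \<Rightarrow> real^'n"
    and c Llo Lhi \<tau> :: real
    and x \<xi> :: "nat \<Rightarrow> real^'n" and Lf :: "nat \<Rightarrow> real" and Lg :: "nat \<Rightarrow> real^'m"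
  assumes f_C1: "\<forall>y. (f has_derivative (\<lambda>h. inner (df y) h)) (at y)" "continuous_on UNIV df"
    and P1_cvx: "convex_on UNIV P1" "continuous_on UNIV P1"
    and P2_cvx: "convex_on UNIV P2" "continuous_on UNIV P2"
    and g_cont: "\<forall>i. continuous_on UNIV (g i)"
    and feas_ne: "\<exists>y. feasible g y"
    and A: "AssumptionA f df P1 P2 g dg"
    and B: "AssumptionB g dg"
    and C: "AssumptionC g dg"
    and D: "AssumptionD df P1 P2 g dg"
    and KL: "KL_function (Fbar f P1 P2 g dg)"
    and alg: "SCP_ls_seq f df P1 P2 g dg c Llo Lhi \<tau> x \<xi> Lf Lg"
  defines "\<Omega> \<equiv> {p. \<exists>r::nat \<Rightarrow> nat. strict_mono r \<and>
                    ((\<lambda>t. (x (Suc t), x t, Lg t)) \<circ> r) \<longlonglongrightarrow> p}"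
  shows "\<exists>xs. x \<longlonglongrightarrow> xs \<and> stationary df P1 P2 g dg xs \<and>
     (\<forall>\<alpha>. 0 \<le> \<alpha> \<and> \<alpha> < 1 \<and> (\<forall>p\<in>\<Omega>. KL_exp_at (Fbar f P1 P2 g dg) p \<alpha>) \<longrightarrow>
        (\<exists>t0::nat. 1 \<le> t0 \<and>
           (\<alpha> = 0 \<longrightarrow> (\<forall>t>t0. x t = xs)) \<and>
           (0 < \<alpha> \<and> \<alpha> \<le> 1/2 \<longrightarrow>
              (\<exists>a0 a1. 0 < a0 \<and> a0 < 1 \<and> 0 < a1 \<and>
                 (\<forall>t>t0. norm (x t - xs) \<le> a1 * a0 ^ t))) \<and>
           (1/2 < \<alpha> \<and> \<alpha> < 1 \<longrightarrow>
              (\<exists>a2>0. \<forall>t>t0. norm (x t - xs) \<le> a2 * real t powr (- ((1 - \<alpha>) / (2 * \<alpha> - 1)))))))"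
proof -
  interpret scp_ls f P1 P2 df g dg c Llo Lhi \<tau> x \<xi> Lf Lg
    by unfold_locales (fact f_C1 P1_cvx P2_cvx g_cont A B C D alg)+
  have "\<Omega> = {p. cluster_point state p}"
    by (simp add: \<Omega>_def cluster_point_def state_def[abs_def])
  then show ?thesis using convergence_with_rates[OF KL] by simp
qed

end
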